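(* Let $f_{xxx}$ be a ternary cubic form over $\mathbb{C}$. The following are equivalent: (1) $F_{6u}=0$ and $\theta_{uuxx}\neq 0$. (2) $f_{xxx}=a_x^2b_x$ for some linearly independent linear forms $a_x,b_x$. Moreover, when these conditions hold, $\operatorname{rank}[f_{xxx}]=3$.
   Context: All forms are homogeneous polynomials with complex coefficients in $x_1,x_2,x_3$ (the zero polynomial is allowed); subscripts indicate degree, so $a_x=a_1x_1+a_2x_2+a_3x_3$ is a linear form and $f_{xxx}$ a cubic form. Let $u_1,u_2,u_3$ be further independent variables and $u_x=u_1x_1+u_2x_2+u_3x_3$. Rank: for a form $f$ of degree $d$, $\operatorname{rank}[f]$ (Waring rank) is the smallest integer $r\ge 0$ such that $f$ is a sum of $r$ $d$-th powers of linear forms in $\mathbb{C}[x_1,x_2,x_3]$. Transvectants: for forms $f,g,h$ in $x_1,x_2,x_3$ (whose coefficients may be polynomials in $u_1,u_2,u_3$, treated as constants), $\mathcal{J}_n[f,g,h]$ is obtained by applying $\Omega^n$ to $f(x)g(y)h(z)$, where $x,y,z$ are three independent triples of variables and $\Omega$ is the differential operator given by the $3\times 3$ determinant with rows $(\partial/\partial x_i)_i$, $(\partial/\partial y_i)_i$, $(\partial/\partial z_i)_i$, and then setting $y=z=x$. Concomitants of $f_{xxx}$: $\theta_{uuxx}=\frac14\mathcal{J}_2[f_{xxx},f_{xxx},u_x^2]$; $F_{6u}=\frac1{3072}\mathcal{J}_2[\theta_{uuxx},\theta_{uuxx},u_x^2]$ (a form of degree 6 in $u_1,u_2,u_3$).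 Equations such as $F_{6u}=0$ mean identical vanishing as polynomials. *)

theory Defs
  imports Complex_Main "HOL-Library.Poly_Mapping" "HOL-Library.Numeral_Type"
begin

text \<open>
  All polynomials live in one ring, over \<open>\<complex>\<close> in the twelve variables
  \<open>x\<^sub>i, y\<^sub>i, z\<^sub>i, u\<^sub>i\<close>. The indices range over the three-element type \<open>3\<close>, in which the
  numeral \<open>3\<close> equals \<open>0\<close>; so \<open>1\<close>, \<open>2\<close>, \<open>3\<close> are precisely its distinct elements.
  A polynomial maps exponent vectors to coefficients, and multiplication is the
  convolution product.
\<close>

datatype var = X 3 | Y 3 | Z 3 | U 3

type_synonym polynomial = "(var \<Rightarrow>\<^sub>0 nat) \<Rightarrow>\<^sub>0 complex"

definition Const :: "complex \<Rightarrow> polynomial" where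
  "Const c = Poly_Mapping.single 0 c"

definition Var :: "var \<Rightarrow> polynomial" where
  "Var v = Poly_Mapping.single (Poly_Mapping.single v 1) 1"

text \<open>Forms of degree \<open>d\<close> in \<open>x\<^sub>1, x\<^sub>2, x\<^sub>3\<close> alone; the zero polynomial is one for every \<open>d\<close>.\<close>

definition form :: "nat \<Rightarrow> polynomial \<Rightarrow> bool" where
  "form d f \<longleftrightarrow> (\<forall>m \<in> Poly_Mapping.keys f.
     Poly_Mapping.keys m \<subseteq> range X \<and>
     (\<Sum>v \<in> Poly_Mapping.keys m. Poly_Mapping.lookup m v) = d)"

definition lin_indep :: "polynomial \<Rightarrow> polynomial \<Rightarrow> bool" where
  "lin_indep a b \<longleftrightarrow> (\<forall>s t. Const s * a + Const t * b = 0 \<longrightarrow> s = 0 \<and> t = 0)"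

text \<open>
  The degree is an argument because the zero form has every degree.
\<close>

definition waring_rank :: "nat \<Rightarrow> polynomial \<Rightarrow> nat" where
  "waring_rank d f =
     (LEAST r. \<exists>l. (\<forall>i<r. form 1 (l i)) \<and> f = (\<Sum>i<r. l i ^ d))"

text \<open>
  The partial derivative. The subtraction of exponents truncates only for monomials
  not containing \<open>v\<close>, and these get the coefficient \<open>0\<close>.
\<close>

definition pdiff :: "var \<Rightarrow> polynomial \<Rightarrow> polynomial" where
  "pdiff v p = (\<Sum>m \<in> Poly_Mapping.keys p.
     Poly_Mapping.single (m - Poly_Mapping.single v 1)
       (of_nat (Poly_Mapping.lookup m v) * Poly_Mapping.lookup p m))"

text \<open>Simultaneous substitution of \<open>\<sigma> v\<close> for each variable \<open>v\<close>.\<close>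

definition psubst :: "(var \<Rightarrow> polynomial) \<Rightarrow> polynomial \<Rightarrow> polynomial" where
  "psubst \<sigma> p = (\<Sum>m \<in> Poly_Mapping.keys p. Const (Poly_Mapping.lookup p m) *
     (\<Prod>v \<in> Poly_Mapping.keys m. \<sigma> v ^ Poly_Mapping.lookup m v))"

fun x_to_y :: "var \<Rightarrow> var" where
  "x_to_y (X i) = Y i"
| "x_to_y v = v"

fun x_to_z :: "var \<Rightarrow> var" where
  "x_to_z (X i) = Z i"
| "x_to_z v = v"

fun yz_to_x :: "var \<Rightarrow> var" where
  "yz_to_x (Y i) = X i"
| "yz_to_x (Z i) = X i"
| "yz_to_x v = v"

definition Omega :: "polynomial \<Rightarrow> polynomial" where
  "Omega p =
      pdiff (X 1) (pdiff (Y 2) (pdiff (Z 3) p)) - pdiff (X 1) (pdiff (Y 3) (pdiff (Z 2) p))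
    - pdiff (X 2) (pdiff (Y 1) (pdiff (Z 3) p)) + pdiff (X 2) (pdiff (Y 3) (pdiff (Z 1) p))
    + pdiff (X 3) (pdiff (Y 1) (pdiff (Z 2) p)) - pdiff (X 3) (pdiff (Y 2) (pdiff (Z 1) p))"

text \<open>
  The arguments are meant to be polynomials in the \<open>x\<^sub>i\<close> and \<open>u\<^sub>i\<close> only.
\<close>

definition transvectant ::
    "nat \<Rightarrow> polynomial \<Rightarrow> polynomial \<Rightarrow> polynomial \<Rightarrow> polynomial" where
  "transvectant n f g h =
     psubst (\<lambda>v. Var (yz_to_x v))
       ((Omega ^^ n)
         (f * psubst (\<lambda>v. Var (x_to_y v)) g * psubst (\<lambda>v. Var (x_to_z v)) h))"

definition u_x :: polynomial where
  "u_x = (\<Sum>i\<in>UNIV. Var (U i) * Var (X i))"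

definition theta :: "polynomial \<Rightarrow> polynomial" where
  "theta f = Const (1 / 4) * transvectant 2 f f (u_x\<^sup>2)"

definition F6u :: "polynomial \<Rightarrow> polynomial" where
  "F6u f = Const (1 / 3072) * transvectant 2 (theta f) (theta f) (u_x\<^sup>2)"

end

theory Submission
  imports Defs "HOL-Analysis.Cartesian_Space" "HOL-Computational_Algebra.Polynomial"
begin

text \<open>
  Up to a constant, \<open>theta f\<close> is \<open>u\<^sup>T adj(Hess f) u\<close> and \<open>F6u f\<close> is \<open>u\<^sup>T adj(Hess theta) u\<close>. If \<open>u\<close> is
  the cross product of \<open>p\<close> and \<open>q\<close>, then \<open>u\<^sup>T adj(A) u\<close> is the Gram determinant of the symmetric
  form \<open>A\<close> on \<open>p, q\<close>; hence, again up to a constant, \<open>F6u f\<close> at \<open>u\<close> is the discriminant of the binary cubic \<open>f (s p + t q)\<close>.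
  So \<open>F6u f = 0\<close> means that \<open>f\<close> has a double root on every line. Restricting to the lines through a
  point off the curve and completing the cube, this becomes \<open>Q\<^sup>3 + R\<^sup>2 = 0\<close> for binary forms \<open>Q, R\<close> of
  degrees 2 and 3, which forces \<open>Q = - l\<^sup>2\<close>, \<open>R = l\<^sup>3\<close> and \<open>f = a\<^sup>2 b\<close>. In that case \<open>theta f\<close> is
  \<open>- 4 a\<^sup>2 det(a, b, u)\<^sup>2\<close>, so it detects linear independence. For \<open>f = l\<^sup>3 + m\<^sup>3\<close> the form \<open>F6u f\<close> is a
  multiple of \<open>det(l, m, u)\<^sup>6\<close> and \<open>theta f\<close> one of \<open>l m det(l, m, u)\<^sup>2\<close>, so two cubes never suffice.
\<close>

section \<open>Substitution and partial derivatives\<close>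

abbreviation monom :: "(var \<Rightarrow> polynomial) \<Rightarrow> (var \<Rightarrow>\<^sub>0 nat) \<Rightarrow> polynomial" where
  "monom \<sigma> m \<equiv> \<Prod>v\<in>Poly_Mapping.keys m. \<sigma> v ^ Poly_Mapping.lookup m v"

lemma Const_0 [simp]: "Const 0 = 0"
  and Const_1 [simp]: "Const 1 = 1"
  by (simp_all add: Const_def)

lemma Const_eq_iff [simp]: "Const a = Const b \<longleftrightarrow> a = b"
  by (metis Const_def lookup_single_eq)

lemma Const_numeral [simp]: "Const (numeral n) = numeral n"
  by (simp add: Const_def)

lemma Const_eq_0_iff [simp]: "Const a = 0 \<longleftrightarrow> a = 0"
  by (metis Const_0 Const_eq_iff)

lemma Const_add: "Const (a + b) = Const a + Const b"
  and Const_minus: "Const (- a) = - Const a"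
  and Const_diff: "Const (a - b) = Const a - Const b"
  and Const_mult: "Const (a * b) = Const a * Const b"
  by (simp_all add: Const_def single_add single_uminus single_diff mult_single)

lemma Const_power: "Const (a ^ n) = Const a ^ n"
  by (induction n) (simp_all add: Const_mult)

lemma monom_superset:
  assumes "finite A" "Poly_Mapping.keys m \<subseteq> A"
  shows "monom \<sigma> m = (\<Prod>v\<in>A. \<sigma> v ^ Poly_Mapping.lookup m v)"
  using assms by (intro prod.mono_neutral_left) (auto simp: in_keys_iff)

lemma monom_add: "monom \<sigma> (m + n) = monom \<sigma> m * monom \<sigma> n"
proof -
  let ?A = "Poly_Mapping.keys m \<union> Poly_Mapping.keys n"
  have "monom \<sigma> (m + n) = (\<Prod>v\<in>?A. \<sigma> v ^ Poly_Mapping.lookup (m + n) v)"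
    using keys_add[of m n] by (intro monom_superset) auto
  also have "\<dots> = monom \<sigma> m * monom \<sigma> n"
    by (simp add: lookup_add power_add prod.distrib monom_superset[of ?A])
  finally show ?thesis .
qed

lemma Var_power: "Var v ^ n = Poly_Mapping.single (Poly_Mapping.single v n) 1"
  by (induction n) (simp_all add: Var_def mult_single flip: single_add single_one)

lemma poly_mapping_sum_singles:
  fixes p :: "'a \<Rightarrow>\<^sub>0 'b :: comm_monoid_add"
  shows "(\<Sum>k\<in>Poly_Mapping.keys p. Poly_Mapping.single k (Poly_Mapping.lookup p k)) = p"
  by (rule poly_mapping_eqI)
    (auto simp: lookup_sum lookup_single when_def in_keys_iff sum.delta')

lemma monom_Var: "monom Var m = Poly_Mapping.single m 1"
proof -
  have "(\<Prod>v\<in>A. Var v ^ Poly_Mapping.lookup m v) =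
      Poly_Mapping.single (\<Sum>v\<in>A. Poly_Mapping.single v (Poly_Mapping.lookup m v)) 1"
    if "finite A" for A
    using that by (induction A) (simp_all add: Var_power mult_single)
  then show ?thesis
    by (simp add: poly_mapping_sum_singles)
qed

lemma single_eq_monom: "Poly_Mapping.single m c = Const c * monom Var m"
  by (simp add: monom_Var Const_def mult_single)

lemma poly_induct_single [case_names add single]:
  fixes p :: polynomial
  assumes "\<And>p q. P p \<Longrightarrow> P q \<Longrightarrow> P (p + q)" "\<And>m c. P (Poly_Mapping.single m c)"
  shows "P p"
proof -
  have "P (\<Sum>m\<in>A. Poly_Mapping.single m (c m))" if "finite A" for A c
    using that
  proof (induction A)
    case empty
    show ?case using assms(2)[of 0 0] by simp
  qed (simp add: assms)
  from this[of "Poly_Mapping.keys p" "Poly_Mapping.lookup p"] show ?thesis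
    by (simp add: poly_mapping_sum_singles)
qed

text \<open>The subring generated by the constants and the variables in \<open>V\<close>. The
  inductive form gives an induction over generators, sums and products, suited to comparing
  derivatives with renamings.\<close>

inductive_set poly_over :: "var set \<Rightarrow> polynomial set" for V where
  Const [intro, simp]: "Const c \<in> poly_over V"
| Var [intro]: "v \<in> V \<Longrightarrow> Var v \<in> poly_over V"
| add [intro, simp]: "p \<in> poly_over V \<Longrightarrow> q \<in> poly_over V \<Longrightarrow> p + q \<in> poly_over V"
| mult [intro, simp]: "p \<in> poly_over V \<Longrightarrow> q \<in> poly_over V \<Longrightarrow> p * q \<in> poly_over V"

lemma poly_over_0_1 [simp]: "0 \<in> poly_over V" "1 \<in> poly_over V"
  using poly_over.Const[of 0 V] poly_over.Const[of 1 V] by simp_all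

lemma poly_over_power [simp]: "p \<in> poly_over V \<Longrightarrow> p ^ n \<in> poly_over V"
  by (induction n) simp_all

lemma poly_over_sum: "(\<And>i. i \<in> A \<Longrightarrow> g i \<in> poly_over V) \<Longrightarrow> sum g A \<in> poly_over V"
  by (induction A rule: infinite_finite_induct) simp_all

lemma poly_over_prod: "(\<And>i. i \<in> A \<Longrightarrow> g i \<in> poly_over V) \<Longrightarrow> prod g A \<in> poly_over V"
  by (induction A rule: infinite_finite_induct) simp_all

lemma poly_over_uminus [simp]: "p \<in> poly_over V \<Longrightarrow> - p \<in> poly_over V"
  using poly_over.mult[OF poly_over.Const[of "-1" V], of p] by (simp add: Const_minus)

lemma poly_over_diff [simp]: "p \<in> poly_over V \<Longrightarrow> q \<in> poly_over V \<Longrightarrow> p - q \<in> poly_over V"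
  using poly_over.add[of p V "- q"] by simp

lemma poly_overI:
  assumes "\<And>m. m \<in> Poly_Mapping.keys p \<Longrightarrow> Poly_Mapping.keys m \<subseteq> V"
  shows "p \<in> poly_over V"
proof -
  have "(\<Sum>m\<in>Poly_Mapping.keys p. Poly_Mapping.single m (Poly_Mapping.lookup p m)) \<in> poly_over V"
    unfolding single_eq_monom using assms
    by (intro poly_over_sum poly_over.mult poly_over_prod poly_over_power poly_over.Var) auto
  then show ?thesis
    by (simp add: poly_mapping_sum_singles)
qed

lemma poly_over_UNIV: "p \<in> poly_over UNIV"
  by (rule poly_overI) simp

section \<open>Substitution as a ring homomorphism\<close>

lemma psubst_single: "psubst \<sigma> (Poly_Mapping.single m c) = Const c * monom \<sigma> m"
  by (simp add: psubst_def)

lemma psubst_add [simp]: "psubst \<sigma> (p + q) = psubst \<sigma> p + psubst \<sigma> q"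
  unfolding psubst_def
  by (rule setsum_keys_plus_distrib) (simp_all add: Const_add distrib_right)

lemma psubst_mult [simp]: "psubst \<sigma> (p * q) = psubst \<sigma> p * psubst \<sigma> q"
proof (induction p rule: poly_induct_single)
  case (single m c)
  show ?case
    by (induction q rule: poly_induct_single)
      (simp_all add: ring_distribs mult_single psubst_single monom_add Const_mult ac_simps)
qed (simp add: ring_distribs)

lemma psubst_Const [simp]: "psubst \<sigma> (Const c) = Const c"
  by (simp add: Const_def psubst_single)

lemma psubst_Var [simp]: "psubst \<sigma> (Var v) = \<sigma> v"
  by (simp add: Var_def psubst_single)

lemma psubst_0 [simp]: "psubst \<sigma> 0 = 0" and psubst_1 [simp]: "psubst \<sigma> 1 = 1"
  using psubst_Const[of \<sigma> 0] psubst_Const[of \<sigma> 1] by simp_all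

lemma psubst_numeral [simp]: "psubst \<sigma> (numeral n) = numeral n"
  using psubst_Const[of \<sigma> "numeral n"] by simp

lemma psubst_power [simp]: "psubst \<sigma> (p ^ n) = psubst \<sigma> p ^ n"
  by (induction n) simp_all

lemma psubst_uminus [simp]: "psubst \<sigma> (- p) = - psubst \<sigma> p"
  using psubst_add[of \<sigma> p "- p"] by (simp add: eq_neg_iff_add_eq_0 add.commute)

lemma psubst_diff [simp]: "psubst \<sigma> (p - q) = psubst \<sigma> p - psubst \<sigma> q"
  using psubst_add[of \<sigma> p "- q"] by simp

section \<open>The partial derivative as a derivation\<close>

lemma pdiff_single: "pdiff v (Poly_Mapping.single m c) =
    Poly_Mapping.single (m - Poly_Mapping.single v 1) (of_nat (Poly_Mapping.lookup m v) * c)"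
  by (simp add: pdiff_def)

lemma pdiff_add [simp]: "pdiff v (p + q) = pdiff v p + pdiff v q"
  unfolding pdiff_def
  by (rule setsum_keys_plus_distrib[where
        f = "\<lambda>m c. Poly_Mapping.single (m - Poly_Mapping.single v 1) (of_nat (Poly_Mapping.lookup m v) * c)"])
    (simp_all add: single_add distrib_left)

lemma pdiff_mult_single:
  "pdiff v (Poly_Mapping.single m c * Poly_Mapping.single n d) =
     pdiff v (Poly_Mapping.single m c) * Poly_Mapping.single n d +
     Poly_Mapping.single m c * pdiff v (Poly_Mapping.single n d)"
proof -
  \<comment> \<open>Truncated subtraction can be moved past \<open>l\<close> if \<open>v\<close>
    occurs in \<open>k\<close>; otherwise both coefficients are zero.\<close>
  have *: "Poly_Mapping.single (k + l - Poly_Mapping.single v 1) (of_nat (Poly_Mapping.lookup k v) * a) =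
      Poly_Mapping.single (k - Poly_Mapping.single v 1 + l) (of_nat (Poly_Mapping.lookup k v) * a)"
    for k l :: "var \<Rightarrow>\<^sub>0 nat" and a :: complex
  proof (cases "Poly_Mapping.lookup k v = 0")
    case False
    then have "k + l - Poly_Mapping.single v 1 = k - Poly_Mapping.single v 1 + l"
      by (intro poly_mapping_eqI) (auto simp: lookup_add lookup_minus lookup_single when_def)
    then show ?thesis by simp
  qed simp
  show ?thesis
    using *[of m n "c * d"] *[of n m "c * d"]
    by (simp add: mult_single pdiff_single lookup_add ring_distribs single_add ac_simps)
qed

lemma pdiff_mult [simp]: "pdiff v (p * q) = pdiff v p * q + p * pdiff v q"
proof (induction p rule: poly_induct_single)
  case (single m c)
  show ?case
    by (induction q rule: poly_induct_single) (simp_all add: ring_distribs pdiff_mult_single)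
qed (simp add: ring_distribs)

lemma pdiff_Const [simp]: "pdiff v (Const c) = 0"
  by (simp add: Const_def pdiff_single)

lemma pdiff_Var: "pdiff v (Var w) = (if v = w then 1 else 0)"
  by (auto simp: Var_def pdiff_single lookup_single)

lemma pdiff_0 [simp]: "pdiff v 0 = 0"
  using pdiff_Const[of v 0] by simp

lemma pdiff_1 [simp]: "pdiff v 1 = 0"
  using pdiff_Const[of v 1] by simp

lemma pdiff_numeral [simp]: "pdiff v (numeral n) = 0"
  using pdiff_Const[of v "numeral n"] by simp

lemma pdiff_uminus [simp]: "pdiff v (- p) = - pdiff v p"
  using pdiff_add[of v p "- p"] by (simp add: eq_neg_iff_add_eq_0 add.commute)

lemma pdiff_diff [simp]: "pdiff v (p - q) = pdiff v p - pdiff v q"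
  using pdiff_add[of v p "- q"] by simp

lemma pdiff_poly_over_eq_0: "p \<in> poly_over V \<Longrightarrow> v \<notin> V \<Longrightarrow> pdiff v p = 0"
  by (induction rule: poly_over.induct) (auto simp: pdiff_Var)

lemma pdiff_in_poly_over [simp]: "p \<in> poly_over V \<Longrightarrow> pdiff v p \<in> poly_over V"
  by (induction rule: poly_over.induct) (auto simp: pdiff_Var)

lemma pdiff_commute: "pdiff v (pdiff w p) = pdiff w (pdiff v p)"
  using poly_over_UNIV[of p]
  by (induction rule: poly_over.induct) (auto simp: pdiff_Var algebra_simps)


lemma pdiff_sum: "pdiff v (sum g A) = (\<Sum>i\<in>A. pdiff v (g i))"
  by (induction A rule: infinite_finite_induct) simp_all

lemma psubst_in_poly_over:
  "p \<in> poly_over V \<Longrightarrow> (\<And>v. v \<in> V \<Longrightarrow> \<sigma> v \<in> poly_over W) \<Longrightarrow> psubst \<sigma> p \<in> poly_over W"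
  by (induction rule: poly_over.induct) auto

section \<open>Transvectants with the square of \<open>u_x\<close>\<close>

abbreviation XU :: "polynomial set" where
  "XU \<equiv> poly_over (range X \<union> range U)"

abbreviation to_y :: "polynomial \<Rightarrow> polynomial" where
  "to_y \<equiv> psubst (\<lambda>v. Var (x_to_y v))"

abbreviation to_z :: "polynomial \<Rightarrow> polynomial" where
  "to_z \<equiv> psubst (\<lambda>v. Var (x_to_z v))"

abbreviation to_x :: "polynomial \<Rightarrow> polynomial" where
  "to_x \<equiv> psubst (\<lambda>v. Var (yz_to_x v))"

lemma to_y_in: "p \<in> XU \<Longrightarrow> to_y p \<in> poly_over (range Y \<union> range U)"
  and to_z_in: "p \<in> XU \<Longrightarrow> to_z p \<in> poly_over (range Z \<union> range U)"
  by (erule psubst_in_poly_over; force)+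

lemma pdiff_XU_eq_0:
  assumes "p \<in> XU"
  shows "pdiff (Y i) p = 0" "pdiff (Z i) p = 0"
    "pdiff (X i) (to_y p) = 0" "pdiff (Z i) (to_y p) = 0"
    "pdiff (X i) (to_z p) = 0" "pdiff (Y i) (to_z p) = 0"
  using pdiff_poly_over_eq_0[OF assms] pdiff_poly_over_eq_0[OF to_y_in[OF assms]]
    pdiff_poly_over_eq_0[OF to_z_in[OF assms]] by auto

lemma pdiff_to_y: "p \<in> XU \<Longrightarrow> pdiff (Y i) (to_y p) = to_y (pdiff (X i) p)"
  and pdiff_to_z: "p \<in> XU \<Longrightarrow> pdiff (Z i) (to_z p) = to_z (pdiff (X i) p)"
  by (induction rule: poly_over.induct) (auto simp: pdiff_Var)

lemma to_x_XU: "p \<in> XU \<Longrightarrow> to_x p = p \<and> to_x (to_y p) = p \<and> to_x (to_z p) = p"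
  by (induction rule: poly_over.induct) auto

lemma Omega_add: "Omega (p + q) = Omega p + Omega q"
  and Omega_diff: "Omega (p - q) = Omega p - Omega q"
  by (simp_all add: Omega_def)

text \<open>Apart from the u-variables the three factors live in disjoint triples, so each
  derivative meets only its own factor. The summands again have the shape of the argument, which
  allows a second application.\<close>

lemma Omega_prod:
  assumes "p \<in> XU" "q \<in> XU" "r \<in> XU"
  shows "Omega (p * to_y q * to_z r) =
      pdiff (X 1) p * to_y (pdiff (X 2) q) * to_z (pdiff (X 3) r)
    - pdiff (X 1) p * to_y (pdiff (X 3) q) * to_z (pdiff (X 2) r)
    - pdiff (X 2) p * to_y (pdiff (X 1) q) * to_z (pdiff (X 3) r)
    + pdiff (X 2) p * to_y (pdiff (X 3) q) * to_z (pdiff (X 1) r)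
    + pdiff (X 3) p * to_y (pdiff (X 1) q) * to_z (pdiff (X 2) r)
    - pdiff (X 3) p * to_y (pdiff (X 2) q) * to_z (pdiff (X 1) r)"
  using assms by (simp add: Omega_def pdiff_XU_eq_0 pdiff_to_y pdiff_to_z)

text \<open>
  Polarization in \<open>A\<close> of \<open>2 u\<^sup>T adj(A) u\<close>, for symmetric matrices: only the entries on and above the
  diagonal are used.
\<close>

definition adjp :: "(3 \<Rightarrow> 3 \<Rightarrow> 'a::comm_ring_1) \<Rightarrow> (3 \<Rightarrow> 3 \<Rightarrow> 'a) \<Rightarrow> (3 \<Rightarrow> 'a) \<Rightarrow> 'a" where
  "adjp A B u =
     (A 2 2 * B 3 3 + B 2 2 * A 3 3 - 2 * A 2 3 * B 2 3) * (u 1)\<^sup>2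
   + (A 1 1 * B 3 3 + B 1 1 * A 3 3 - 2 * A 1 3 * B 1 3) * (u 2)\<^sup>2
   + (A 1 1 * B 2 2 + B 1 1 * A 2 2 - 2 * A 1 2 * B 1 2) * (u 3)\<^sup>2
   + 2 * (A 1 3 * B 2 3 + B 1 3 * A 2 3 - A 1 2 * B 3 3 - B 1 2 * A 3 3) * u 1 * u 2
   + 2 * (A 1 2 * B 2 3 + B 1 2 * A 2 3 - A 1 3 * B 2 2 - B 1 3 * A 2 2) * u 1 * u 3
   + 2 * (A 1 2 * B 1 3 + B 1 2 * A 1 3 - A 1 1 * B 2 3 - B 1 1 * A 2 3) * u 2 * u 3"

abbreviation hess :: "polynomial \<Rightarrow> 3 \<Rightarrow> 3 \<Rightarrow> polynomial" where
  "hess p i j \<equiv> pdiff (X i) (pdiff (X j) p)"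

lemma u_x_in: "u_x \<in> XU"
  unfolding u_x_def by (auto intro!: poly_over_sum)

lemma pdiff_X_u_x: "pdiff (X i) u_x = Var (U i)"
  by (simp add: u_x_def pdiff_sum pdiff_Var if_distrib[of "\<lambda>x. _ * x"] cong: if_cong)

text \<open>The z-derivatives of \<open>u_x\<^sup>2\<close> leave 2 u_i u_j, and the two
  determinants contract the Hessians of \<open>p\<close> and \<open>q\<close> into the polarized
  adjugate.\<close>

lemma transvectant_u_x:
  assumes "p \<in> XU" "q \<in> XU"
  shows "transvectant 2 p q (u_x\<^sup>2) = 2 * adjp (hess p) (hess q) (\<lambda>i. Var (U i))"
proof -
  have U: "Var (U i) \<in> XU" for i by auto
  have 1: "pdiff (X i) (u_x\<^sup>2) = 2 * Var (U i) * u_x" for i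
    by (simp add: power2_eq_square pdiff_X_u_x)
  have [simp]: "2 * Var (U j) * u_x \<in> XU" for j
    using u_x_in U poly_over.Const[of 2] by simp
  have [simp]: "to_x (to_z (2 * Var (U i) * Var (U j))) = 2 * Var (U i) * Var (U j)" for i j
    by simp
  show ?thesis
    unfolding transvectant_def adjp_def numeral_2_eq_2 funpow.simps o_def id_def
    unfolding numeral_2_eq_2[symmetric]
    using assms u_x_in
    \<comment> \<open>\<open>psubst_mult\<close> stays off: splitting \<open>to_z\<close> of a
      product would destroy the pattern on which \<open>Omega_prod\<close> has to match a second
      time.\<close>
    by (simp add: Omega_prod 1 pdiff_X_u_x pdiff_Var Omega_add Omega_diff to_x_XU
      pdiff_commute[of "X 2" "X 1"] pdiff_commute[of "X 3" "X 1"] pdiff_commute[of "X 3" "X 2"]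
      del: psubst_mult psubst_power)
     (simp add: to_x_XU algebra_simps power2_eq_square)
qed

section \<open>Binary cubics with vanishing discriminant\<close>

text \<open>If Q^3 = -R^2 for binary forms, unique factorization makes -Q a square and R the
  matching cube. The linear form l s + m t is found by comparing coefficients.\<close>

lemma binary_square_plus_cube_eq_0:
  fixes q0 q1 q2 r0 r1 r2 r3 :: complex
  assumes "\<And>s t. (q0 * s\<^sup>2 + 2 * q1 * s * t + q2 * t\<^sup>2) ^ 3 +
    (r0 * s ^ 3 + 3 * r1 * s\<^sup>2 * t + 3 * r2 * s * t\<^sup>2 + r3 * t ^ 3)\<^sup>2 = 0"
  obtains l m where "q0 = - l\<^sup>2" "q1 = - l * m" "q2 = - m\<^sup>2"
    "r0 = l ^ 3" "r1 = l\<^sup>2 * m" "r2 = l * m\<^sup>2" "r3 = m ^ 3"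
proof -
  \<comment> \<open>The left-hand side at \<open>t = 1\<close>, as a polynomial in
    \<open>s\<close>.\<close>
  let ?P = "[:q2 ^ 3 + r3\<^sup>2, 6 * q1 * q2\<^sup>2 + 6 * r2 * r3,
    3 * q0 * q2\<^sup>2 + 12 * q1\<^sup>2 * q2 + 9 * r2\<^sup>2 + 6 * r1 * r3,
    8 * q1 ^ 3 + 12 * q0 * q1 * q2 + 2 * r0 * r3 + 18 * r1 * r2,
    3 * q0\<^sup>2 * q2 + 12 * q0 * q1\<^sup>2 + 9 * r1\<^sup>2 + 6 * r0 * r2,
    6 * q0\<^sup>2 * q1 + 6 * r0 * r1, q0 ^ 3 + r0\<^sup>2:]"
  have "poly ?P s = 0" for s
    using assms[of s 1] by simp algebra
  then have "?P = 0"
    using poly_all_0_iff_0 by blast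
  then have e0: "q2 ^ 3 + r3\<^sup>2 = 0"
    and e2: "3 * q0 * q2\<^sup>2 + 12 * q1\<^sup>2 * q2 + 9 * r2\<^sup>2 + 6 * r1 * r3 = 0"
    and e3: "8 * q1 ^ 3 + 12 * q0 * q1 * q2 + 2 * r0 * r3 + 18 * r1 * r2 = 0"
    and e4: "3 * q0\<^sup>2 * q2 + 12 * q0 * q1\<^sup>2 + 9 * r1\<^sup>2 + 6 * r0 * r2 = 0"
    and e5: "6 * q0\<^sup>2 * q1 + 6 * r0 * r1 = 0" and e6: "q0 ^ 3 + r0\<^sup>2 = 0"
    by simp_all
  show thesis
  proof (cases "q0 = 0")
    case True
    \<comment> \<open>Here l = 0: the equations eliminate r0, r1, q1, r2 in turn, each being reduced
      to a power of the next unknown.\<close>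
    then have "r0 = 0" using e6 by simp
    moreover then have "r1 = 0" using e4 True by simp
    moreover then have "q1 = 0" using e3 True \<open>r0 = 0\<close> by simp
    moreover then have "r2 = 0" using e2 True \<open>r1 = 0\<close> by simp
    moreover have "\<exists>m. q2 = - m\<^sup>2 \<and> r3 = m ^ 3"
    proof (cases "q2 = 0")
      case True
      then show ?thesis using e0 by (intro exI[of _ 0]) simp
    next
      case False
      have "r3\<^sup>2 = - (q2 ^ 3)" using e0 by algebra
      with False show ?thesis
        by (intro exI[of _ "- r3 / q2"])
          (simp add: power2_eq_square power3_eq_cube field_simps)
    qed
    ultimately show thesis using that[of 0] True by auto
  next
    case False
    \<comment> \<open>If Q = -L^2 and R = L^3, then L = -R / Q; this is the quotient of the leading
      coefficients.\<close>
    define l where "l = - r0 / q0"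
    have "r0\<^sup>2 = - (q0 ^ 3)" using e6 by algebra
    then have q0: "q0 = - l\<^sup>2"
      using False by (simp add: l_def power2_eq_square power3_eq_cube field_simps)
    have r0: "r0 = l ^ 3"
    proof -
      have "l * q0 = - r0" using False by (simp add: l_def)
      then show ?thesis using q0 by algebra
    qed
    have l: "l \<noteq> 0" using q0 False by auto
    define m where "m = - q1 / l"
    have q1: "q1 = - l * m" using l by (simp add: m_def)
    \<comment> \<open>\<open>e\<close> measures how far Q is from -(l s + m t)^2. The next equations
      express r1, r2, r3 through l, m, e, and the last one forces \<open>e\<close> to
      vanish.\<close>
    define e where "e = q2 + m\<^sup>2"
    have q2: "q2 = e - m\<^sup>2" by (simp add: e_def)
    have "l ^ 3 * (r1 - l\<^sup>2 * m) = 0"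
      using e5 unfolding q0 r0 q1 by algebra
    then have r1: "r1 = l\<^sup>2 * m" using l by simp
    have "l ^ 3 * (2 * r2 - 2 * l * m\<^sup>2 + l * e) = 0"
      using e4 unfolding q0 r0 q1 q2 r1 by algebra
    then have "2 * r2 - 2 * l * m\<^sup>2 + l * e = 0" using l by simp
    then have r2: "r2 = l * m\<^sup>2 - l * e / 2" by algebra
    have "l ^ 3 * (r3 - m ^ 3 + 3 / 2 * m * e) = 0"
      using e3 unfolding q0 r0 q1 q2 r1 r2 by algebra
    then have "r3 - m ^ 3 + 3 / 2 * m * e = 0" using l by simp
    then have r3: "r3 = m ^ 3 - 3 / 2 * m * e" by algebra
    have "l\<^sup>2 * e\<^sup>2 = 0"
      using e2 unfolding q0 r0 q1 q2 r1 r2 r3 by algebra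
    then have "e = 0" using l by simp
    then show thesis
      using that[of l m] q0 q1 q2 r0 r1 r2 r3 by simp
  qed
qed

text \<open>
  The discriminant of \<open>A s\<^sup>3 + 3 B s\<^sup>2 t + 3 C s t\<^sup>2 + D t\<^sup>3\<close> divided by \<open>- 27\<close>, written as the
  discriminant of its Hessian.
\<close>

definition disc3 :: "complex \<Rightarrow> complex \<Rightarrow> complex \<Rightarrow> complex \<Rightarrow> complex" where
  "disc3 A B C D = (A * D - B * C)\<^sup>2 - 4 * (A * C - B\<^sup>2) * (B * D - C\<^sup>2)"

text \<open>Completing the cube: with y = x + B the cubic x^3 + 3 B x^2 + 3 C x + D becomes y^3 + 3
  Q y + 2 R, where Q = C - B^2 and 2 R = D - 3 B C + 2 B^3. Its \<open>disc3\<close> is 4 (Q^3 +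
  R^2).\<close>

lemma square_factor_monic:
  fixes b1 b2 c0 c1 c2 d0 d1 d2 d3 :: complex
  assumes "\<And>s t. disc3 1 (b1 * s + b2 * t) (c0 * s\<^sup>2 + 2 * c1 * s * t + c2 * t\<^sup>2)
     (d0 * s ^ 3 + 3 * d1 * s\<^sup>2 * t + 3 * d2 * s * t\<^sup>2 + d3 * t ^ 3) = 0"
  shows "\<exists>l m k n. \<forall>x s t. x ^ 3 + 3 * (b1 * s + b2 * t) * x\<^sup>2 + 3 * (c0 * s\<^sup>2 + 2 * c1 * s * t + c2 * t\<^sup>2) * x +
      (d0 * s ^ 3 + 3 * d1 * s\<^sup>2 * t + 3 * d2 * s * t\<^sup>2 + d3 * t ^ 3) =
      (x + l * s + m * t)\<^sup>2 * (x + k * s + n * t)"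
proof -
  define q0 q1 q2 where "q0 = c0 - b1\<^sup>2" and "q1 = c1 - b1 * b2" and "q2 = c2 - b2\<^sup>2"
  define r0 r1 r2 r3 where "r0 = (d0 - 3 * b1 * c0 + 2 * b1 ^ 3) / 2"
    and "r1 = (d1 - b2 * c0 - 2 * b1 * c1 + 2 * b1\<^sup>2 * b2) / 2"
    and "r2 = (d2 - b1 * c2 - 2 * b2 * c1 + 2 * b1 * b2\<^sup>2) / 2"
    and "r3 = (d3 - 3 * b2 * c2 + 2 * b2 ^ 3) / 2"
  have c: "c0 = q0 + b1\<^sup>2" "c1 = q1 + b1 * b2" "c2 = q2 + b2\<^sup>2"
    by (simp_all add: q0_def q1_def q2_def)
  have d: "d0 = 2 * r0 + 3 * b1 * c0 - 2 * b1 ^ 3"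
    "d1 = 2 * r1 + b2 * c0 + 2 * b1 * c1 - 2 * b1\<^sup>2 * b2"
    "d2 = 2 * r2 + b1 * c2 + 2 * b2 * c1 - 2 * b1 * b2\<^sup>2"
    "d3 = 2 * r3 + 3 * b2 * c2 - 2 * b2 ^ 3"
    unfolding r0_def r1_def r2_def r3_def by algebra+
  have disc: "disc3 1 B (Q + B\<^sup>2) (2 * R + 3 * B * (Q + B\<^sup>2) - 2 * B ^ 3) = 4 * (Q ^ 3 + R\<^sup>2)"
    for B Q R unfolding disc3_def by algebra
  have *: "(q0 * s\<^sup>2 + 2 * q1 * s * t + q2 * t\<^sup>2) ^ 3 +
    (r0 * s ^ 3 + 3 * r1 * s\<^sup>2 * t + 3 * r2 * s * t\<^sup>2 + r3 * t ^ 3)\<^sup>2 = 0" (is "?Q ^ 3 + ?R\<^sup>2 = 0") for s t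
  proof -
    let ?B = "b1 * s + b2 * t"
    have 1: "c0 * s\<^sup>2 + 2 * c1 * s * t + c2 * t\<^sup>2 = ?Q + ?B\<^sup>2"
      unfolding c by algebra
    have 2: "d0 * s ^ 3 + 3 * d1 * s\<^sup>2 * t + 3 * d2 * s * t\<^sup>2 + d3 * t ^ 3 =
        2 * ?R + 3 * ?B * (?Q + ?B\<^sup>2) - 2 * ?B ^ 3"
      unfolding 1[symmetric] d by algebra
    show ?thesis
      using assms[of s t] unfolding 1 2 disc by (simp only: mult_eq_0_iff) simp
  qed
  then obtain l m where lm: "q0 = - l\<^sup>2" "q1 = - l * m" "q2 = - m\<^sup>2"
      "r0 = l ^ 3" "r1 = l\<^sup>2 * m" "r2 = l * m\<^sup>2" "r3 = m ^ 3"
    by (rule binary_square_plus_cube_eq_0)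
  show ?thesis
  \<comment> \<open>With L = l s + m t the reduced cubic is y^3 - 3 L^2 y + 2 L^3 = (y - L)^2 (y + 2
    L); now put y = x + B.\<close>
  proof (rule exI[of _ "b1 - l"], rule exI[of _ "b2 - m"], rule exI[of _ "b1 + 2 * l"],
      rule exI[of _ "b2 + 2 * m"], intro allI)
    show "x ^ 3 + 3 * (b1 * s + b2 * t) * x\<^sup>2 + 3 * (c0 * s\<^sup>2 + 2 * c1 * s * t + c2 * t\<^sup>2) * x +
      (d0 * s ^ 3 + 3 * d1 * s\<^sup>2 * t + 3 * d2 * s * t\<^sup>2 + d3 * t ^ 3) =
      (x + (b1 - l) * s + (b2 - m) * t)\<^sup>2 * (x + (b1 + 2 * l) * s + (b2 + 2 * m) * t)" for x s t
      unfolding d c lm by algebra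
  qed
qed

section \<open>Symmetric trilinear forms\<close>

definition bil :: "(3 \<Rightarrow> 3 \<Rightarrow> 'a::comm_ring_1) \<Rightarrow> (3 \<Rightarrow> 'a) \<Rightarrow> (3 \<Rightarrow> 'a) \<Rightarrow> 'a" where
  "bil A p q = (\<Sum>i\<in>UNIV. \<Sum>j\<in>UNIV. A i j * p i * q j)"

definition tri :: "(3 \<Rightarrow> 3 \<Rightarrow> 3 \<Rightarrow> 'a::comm_ring_1) \<Rightarrow> (3 \<Rightarrow> 'a) \<Rightarrow> (3 \<Rightarrow> 'a) \<Rightarrow> (3 \<Rightarrow> 'a) \<Rightarrow> 'a" where
  "tri F p q r = (\<Sum>i\<in>UNIV. p i * bil (F i) q r)"

definition sym3 :: "(3 \<Rightarrow> 3 \<Rightarrow> 3 \<Rightarrow> 'a) \<Rightarrow> bool" where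
  "sym3 F \<longleftrightarrow> (\<forall>i j k. F i j k = F j i k \<and> F i j k = F i k j)"

definition cross :: "(3 \<Rightarrow> 'a::comm_ring_1) \<Rightarrow> (3 \<Rightarrow> 'a) \<Rightarrow> 3 \<Rightarrow> 'a" where
  "cross p q i = (if i = 1 then p 2 * q 3 - p 3 * q 2
    else if i = 2 then p 3 * q 1 - p 1 * q 3 else p 1 * q 2 - p 2 * q 1)"

lemma cross_simps [simp]:
  "cross p q 1 = p 2 * q 3 - p 3 * q 2" "cross p q 2 = p 3 * q 1 - p 1 * q 3"
  "cross p q 3 = p 1 * q 2 - p 2 * q 1"
  by (simp_all add: cross_def)

text \<open>A polarized Cauchy-Binet identity: for \<open>A = B\<close> the right side is twice the
  Gram determinant of \<open>A\<close> on \<open>p\<close>, \<open>q\<close>. Symmetry enters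
  because \<open>adjp\<close> reads only the upper triangle.\<close>

lemma adjp_cross:
  assumes "\<And>i j. A i j = A j i" "\<And>i j. B i j = B j i"
  shows "adjp A B (cross p q) =
    bil A p p * bil B q q + bil B p p * bil A q q - 2 * bil A p q * bil B p q"
  unfolding adjp_def bil_def sum_3 cross_simps
    assms(1)[of 2 1] assms(1)[of 3 1] assms(1)[of 3 2]
    assms(2)[of 2 1] assms(2)[of 3 1] assms(2)[of 3 2]
  by (simp add: algebra_simps power2_eq_square)

lemma tri_linear:
  "tri F (\<lambda>i. a * p i + b * q i) r s = a * tri F p r s + b * tri F q r s"
  by (simp add: tri_def sum_distrib_left algebra_simps sum.distrib)

lemma bil_commute: "(\<And>i j. A i j = A j i) \<Longrightarrow> bil A p q = bil A q p"
  unfolding bil_def by (subst sum.swap) (simp add: ac_simps)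

lemma sym3D: "sym3 F \<Longrightarrow> F i j k = F j i k" "sym3 F \<Longrightarrow> F i j k = F i k j"
  by (simp_all add: sym3_def)

lemma tri_commute:
  assumes "sym3 F"
  shows "tri F p q r = tri F p r q" "tri F p q r = tri F q p r"
proof -
  show "tri F p q r = tri F p r q" for p q r
    unfolding tri_def using sym3D(2)[OF assms] by (simp add: bil_commute[of "F _" q])
  have "tri F p q r = (\<Sum>i\<in>UNIV. \<Sum>j\<in>UNIV. \<Sum>k\<in>UNIV. F i j k * p i * q j * r k)" for p q r
    by (simp add: tri_def bil_def sum_distrib_left ac_simps)
  then show "tri F p q r = tri F q p r"
    by (simp, subst sum.swap) (simp add: sym3D(1)[OF assms] ac_simps)
qed


lemma tri_linear2:
  assumes "sym3 F"
  shows "tri F r (\<lambda>i. a * p i + b * q i) s = a * tri F r p s + b * tri F r q s"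
    "tri F r s (\<lambda>i. a * p i + b * q i) = a * tri F r s p + b * tri F r s q"
proof -
  show *: "tri F r (\<lambda>i. a * p i + b * q i) s = a * tri F r p s + b * tri F r q s" for r s
    by (metis (no_types) tri_commute(2)[OF assms] tri_linear)
  show "tri F r s (\<lambda>i. a * p i + b * q i) = a * tri F r s p + b * tri F r s q"
    by (metis (no_types) tri_commute(1)[OF assms] *)
qed

lemma tri_square_comb:
  assumes "sym3 F"
  shows "tri F r (\<lambda>i. a * p i + b * q i) (\<lambda>i. a * p i + b * q i) =
    a\<^sup>2 * tri F r p p + 2 * a * b * tri F r p q + b\<^sup>2 * tri F r q q"
  unfolding tri_linear2[OF assms] tri_commute(1)[OF assms, of r q p]
  by (simp add: algebra_simps power2_eq_square)

lemma tri_cube_comb: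
  assumes "sym3 F"
  shows "tri F (\<lambda>i. a * p i + b * q i) (\<lambda>i. a * p i + b * q i) (\<lambda>i. a * p i + b * q i) =
    a ^ 3 * tri F p p p + 3 * a\<^sup>2 * b * tri F p p q + 3 * a * b\<^sup>2 * tri F p q q + b ^ 3 * tri F q q q"
proof -
  have "tri F q p p = tri F p p q" "tri F q p q = tri F p q q"
    by (metis (no_types) tri_commute[OF assms])+
  then show ?thesis
    unfolding tri_square_comb[OF assms] tri_linear
    by (simp add: algebra_simps power2_eq_square power3_eq_cube)
qed

definition basis :: "3 \<Rightarrow> 3 \<Rightarrow> 'a::comm_ring_1" where
  "basis i j = (if i = j then 1 else 0)"

lemma basis_same [simp]: "basis i i = 1"
  by (simp add: basis_def)

lemma tri_basis: "tri F (basis i) (basis j) (basis k) = F i j k"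
proof -
  have *: "(\<Sum>j\<in>UNIV. basis i j * g j) = g i" "(\<Sum>j\<in>UNIV. g j * basis i j) = g i"
    for i and g :: "3 \<Rightarrow> 'a"
    by (simp_all add: basis_def if_distrib[of "\<lambda>x. _ * x"] if_distrib[of "\<lambda>x. x * _"] cong: if_cong)
  show ?thesis
    unfolding tri_def bil_def * by (simp add: * mult.assoc flip: sum_distrib_left)
qed

text \<open>Supplies the base point for the lines in \<open>square_factor_if_disc3_eq_0\<close>. A
  cubic vanishing on the whole plane \<open>p 1 = 1\<close> vanishes by homogeneity wherever the
  first coordinate is nonzero, hence everywhere.\<close>

lemma nonzero_at_first_coordinate_1:
  fixes F :: "3 \<Rightarrow> 3 \<Rightarrow> 3 \<Rightarrow> complex"
  assumes F: "sym3 F" and x: "tri F x x x \<noteq> 0"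
  obtains p where "p 1 = 1" "tri F p p p \<noteq> 0"
proof (rule ccontr)
  assume "\<not> thesis"
  then have *: "tri F p p p = 0" if "p 1 = 1" for p
    using that \<open>\<And>p. p 1 = 1 \<Longrightarrow> tri F p p p \<noteq> 0 \<Longrightarrow> thesis\<close> by blast
  have **: "tri F p p p = 0" if "p 1 \<noteq> 0" for p
  proof -
    let ?q = "\<lambda>i. p i / p 1"
    have "tri F (\<lambda>i. p 1 * ?q i + 0 * ?q i) (\<lambda>i. p 1 * ?q i + 0 * ?q i) (\<lambda>i. p 1 * ?q i + 0 * ?q i) = 0"
      unfolding tri_cube_comb[OF F] using *[of ?q] that by simp
    then show ?thesis using that by simp
  qed
  have "x 1 = 0" using ** x by blast
  let ?y = "\<lambda>z i. 1 * x i + z * basis 1 i"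
  have "tri F (?y z) (?y z) (?y z) = 0" if "z \<noteq> 0" for z
    using that \<open>x 1 = 0\<close> by (intro **) simp
  \<comment> \<open>A polynomial in \<open>z\<close> of degree at most 3 with four roots is zero, so
    its constant term \<open>tri F x x x\<close> is zero.\<close>
  from this[of 1] this[of "-1"] this[of 2] this[of "-2"] show False
    using x unfolding tri_cube_comb[OF F] by simp algebra
qed

lemma disc3_scale: "A \<noteq> 0 \<Longrightarrow> disc3 1 (B / A) (C / A) (D / A) = disc3 A B C D / A ^ 4"
  by (simp add: disc3_def field_simps power2_eq_square eval_nat_numeral)

text \<open>In the basis \<open>p\<close>, \<open>basis 2\<close>, \<open>basis 3\<close> with
  \<open>p\<close> off the curve, the cubic has a nonzero leading coefficient \<open>A\<close> in
  the direction \<open>p\<close>. After division by \<open>A\<close>, the discriminants on lines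
  through \<open>p\<close> are those of \<open>square_factor_monic\<close>.\<close>

lemma square_factor_if_disc3_eq_0:
  assumes F: "sym3 F"
    and disc: "\<And>p q. disc3 (tri F p p p) (tri F p p q) (tri F p q q) (tri F q q q) = 0"
  shows "\<exists>\<alpha> \<beta>. \<forall>x. tri F x x x = (\<Sum>i\<in>UNIV. \<alpha> i * x i)\<^sup>2 * (\<Sum>i\<in>UNIV. \<beta> i * x i)"
proof (cases "\<forall>x. tri F x x x = 0")
  case True
  then show ?thesis by (intro exI[of _ "\<lambda>_. 0"]) simp
next
  case False
  then obtain p where p: "p 1 = 1" "tri F p p p \<noteq> 0"
    using nonzero_at_first_coordinate_1[OF F] by blast
  define A where "A = tri F p p p"
  let ?v = "basis 2" and ?w = "basis 3"
  let ?b1 = "tri F p p ?v" and ?b2 = "tri F p p ?w"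
  let ?c0 = "tri F p ?v ?v" and ?c1 = "tri F p ?v ?w" and ?c2 = "tri F p ?w ?w"
  let ?d0 = "tri F ?v ?v ?v" and ?d1 = "tri F ?v ?v ?w" and ?d2 = "tri F ?v ?w ?w"
    and ?d3 = "tri F ?w ?w ?w"
  have A: "A \<noteq> 0" using p by (simp add: A_def)
  have "disc3 1 (?b1 / A * s + ?b2 / A * t)
      (?c0 / A * s\<^sup>2 + 2 * (?c1 / A) * s * t + ?c2 / A * t\<^sup>2)
      (?d0 / A * s ^ 3 + 3 * (?d1 / A) * s\<^sup>2 * t + 3 * (?d2 / A) * s * t\<^sup>2 + ?d3 / A * t ^ 3) = 0"
    (is "disc3 1 ?B ?C ?D = 0") for s t
  proof -
    let ?q = "\<lambda>i. s * ?v i + t * ?w i"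
    have "?B = tri F p p ?q / A" "?C = tri F p ?q ?q / A" "?D = tri F ?q ?q ?q / A"
      unfolding tri_cube_comb[OF F] tri_square_comb[OF F] tri_linear2[OF F]
      by (simp_all add: add_divide_distrib ac_simps)
    then show ?thesis
      using disc[of p ?q] A by (simp add: disc3_scale flip: A_def)
  qed
  from square_factor_monic[OF this] obtain l m k n where lm: "x ^ 3 + 3 * (?b1 / A * s + ?b2 / A * t) * x\<^sup>2 +
      3 * (?c0 / A * s\<^sup>2 + 2 * (?c1 / A) * s * t + ?c2 / A * t\<^sup>2) * x +
      (?d0 / A * s ^ 3 + 3 * (?d1 / A) * s\<^sup>2 * t + 3 * (?d2 / A) * s * t\<^sup>2 + ?d3 / A * t ^ 3) =
      (x + l * s + m * t)\<^sup>2 * (x + k * s + n * t)" for x s t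
    by blast
  \<comment> \<open>The coefficients of the two factors after inserting s = x_2 - x_1 p_2 and t =
    x_3 - x_1 p_3; \<open>\<beta>\<close> absorbs \<open>A\<close>.\<close>
  define \<alpha> \<beta> where "\<alpha> i = (if i = 1 then 1 - l * p 2 - m * p 3 else if i = 2 then l else m)"
    and "\<beta> i = A * (if i = 1 then 1 - k * p 2 - n * p 3 else if i = 2 then k else n)" for i :: 3
  have "tri F x x x = (\<Sum>i\<in>UNIV. \<alpha> i * x i)\<^sup>2 * (\<Sum>i\<in>UNIV. \<beta> i * x i)" for x
  proof -
    define s t where "s = x 2 - x 1 * p 2" and "t = x 3 - x 1 * p 3"
    let ?q = "\<lambda>i. s * ?v i + t * ?w i"
    let ?y = "\<lambda>i. x 1 * p i + 1 * ?q i"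
    have "?y i = x i" for i
      using exhaust_3[of i] by (auto simp: s_def t_def basis_def p)
    then have "tri F x x x = tri F ?y ?y ?y" by simp
    also have "\<dots> = (x 1) ^ 3 * A + 3 * (x 1)\<^sup>2 * tri F p p ?q +
        3 * x 1 * tri F p ?q ?q + tri F ?q ?q ?q"
      unfolding tri_cube_comb[OF F, of "x 1" p 1 ?q] by (simp add: A_def)
    also have "\<dots> = A * ((x 1 + l * s + m * t)\<^sup>2 * (x 1 + k * s + n * t))"
      unfolding lm[symmetric] tri_cube_comb[OF F] tri_square_comb[OF F] tri_linear2[OF F]
      using A by (simp add: algebra_simps)
    also have "\<dots> = (\<Sum>i\<in>UNIV. \<alpha> i * x i)\<^sup>2 * (\<Sum>i\<in>UNIV. \<beta> i * x i)"
      unfolding sum_3 \<alpha>_def \<beta>_def s_def t_def by simp algebra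
    finally show ?thesis .
  qed
  then show ?thesis by blast
qed

lemma tri_polarization:
  fixes F G :: "3 \<Rightarrow> 3 \<Rightarrow> 3 \<Rightarrow> complex"
  assumes F: "sym3 F" and G: "sym3 G" and eq: "\<And>x. tri F x x x = tri G x x x"
  shows "F = G"
proof -
  \<comment> \<open>Adding the values at p + q and q - p cancels the terms odd in p and isolates
    \<open>tri F p p q\<close>.\<close>
  have ppq: "tri F p p q = tri G p p q" for p q
    using eq[of "\<lambda>i. 1 * p i + 1 * q i"] eq[of "\<lambda>i. (-1) * p i + 1 * q i"] eq[of p] eq[of q]
    unfolding tri_cube_comb[OF F] tri_cube_comb[OF G] by simp algebra
  have rpp: "tri F r p p = tri G r p p" for p r
    using ppq[of p r] by (metis (no_types) tri_commute[OF F] tri_commute[OF G])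
  have "tri F r p q = tri G r p q" for p q r
    using rpp[of r "\<lambda>i. 1 * p i + 1 * q i"] rpp[of r p] rpp[of r q]
    unfolding tri_square_comb[OF F] tri_square_comb[OF G] by simp
  then have "F i j k = G i j k" for i j k
    using tri_basis by metis
  then show ?thesis by (intro ext)
qed

section \<open>Linear and cubic forms\<close>

definition linear_form :: "(3 \<Rightarrow> complex) \<Rightarrow> polynomial" where
  "linear_form \<alpha> = (\<Sum>i\<in>UNIV. Const (\<alpha> i) * Var (X i))"

text \<open>Nested by variables, to match both the repeated use of \<open>form_Suc_cases\<close> and
  differentiation by \<open>pdiff_combination\<close>.\<close>

definition cubic :: "(3 \<Rightarrow> 3 \<Rightarrow> 3 \<Rightarrow> complex) \<Rightarrow> polynomial" where
  "cubic F = (\<Sum>i\<in>UNIV. (\<Sum>j\<in>UNIV. linear_form (F i j) * Var (X j)) * Var (X i))"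

section \<open>Homogeneous forms and their coefficient arrays\<close>

definition mdeg :: "('a \<Rightarrow>\<^sub>0 nat) \<Rightarrow> nat" where
  "mdeg m = (\<Sum>v\<in>Poly_Mapping.keys m. Poly_Mapping.lookup m v)"

lemma mdeg_add: "mdeg (m + n) = mdeg m + mdeg n"
  unfolding mdeg_def by (rule setsum_keys_plus_distrib) simp_all

lemma mdeg_single [simp]: "mdeg (Poly_Mapping.single v k) = k"
  by (simp add: mdeg_def)

lemma form_iff: "form d f \<longleftrightarrow>
    (\<forall>m\<in>Poly_Mapping.keys f. Poly_Mapping.keys m \<subseteq> range X \<and> mdeg m = d)"
  by (simp add: form_def mdeg_def)

lemma form_0: "form d 0"
  by (simp add: form_def)

lemma form_add: "form d f \<Longrightarrow> form d g \<Longrightarrow> form d (f + g)"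
  using keys_add[of f g] by (auto simp: form_def)

lemma form_sum: "(\<And>i. i \<in> A \<Longrightarrow> form d (g i)) \<Longrightarrow> form d (sum g A)"
  by (induction A rule: infinite_finite_induct) (simp_all add: form_0 form_add)

lemma form_linear_form: "form 1 (linear_form \<alpha>)"
  unfolding linear_form_def
  by (intro form_sum) (simp add: Const_def Var_def mult_single form_iff)

text \<open>Every monomial of positive degree contains a variable. Choosing one by
  \<open>\<iota>\<close> and grouping the monomials by this choice gives the
  \<open>g i\<close>.\<close>

lemma form_Suc_cases:
  assumes "form (Suc d) f"
  obtains g where "\<And>i. form d (g i)" "f = (\<Sum>i\<in>UNIV. g i * Var (X i))"
proof -
  let ?K = "Poly_Mapping.keys f"
  have "\<exists>i. X i \<in> Poly_Mapping.keys m" if "m \<in> ?K" for m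
  proof -
    have "Poly_Mapping.keys m \<noteq> {}" "Poly_Mapping.keys m \<subseteq> range X"
      using assms that by (auto simp: form_def)
    then show ?thesis by blast
  qed
  then obtain \<iota> where \<iota>: "X (\<iota> m) \<in> Poly_Mapping.keys m" if "m \<in> ?K" for m
    by metis
  define r where "r m = m - Poly_Mapping.single (X (\<iota> m)) 1" for m :: "var \<Rightarrow>\<^sub>0 nat"
  have r: "r m + Poly_Mapping.single (X (\<iota> m)) 1 = m" if "m \<in> ?K" for m
    using \<iota>[OF that]
    by (intro poly_mapping_eqI)
      (auto simp: r_def lookup_add lookup_minus lookup_single when_def in_keys_iff)
  define g where "g i = (\<Sum>m\<in>{m\<in>?K. \<iota> m = i}. Poly_Mapping.single (r m) (Poly_Mapping.lookup f m))" for i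
  show thesis
  proof (rule that)
    show "form d (g i)" for i
      unfolding g_def
    proof (rule form_sum)
      fix m assume "m \<in> {m\<in>?K. \<iota> m = i}"
      then have m: "m \<in> ?K" by simp
      then have "mdeg (r m) + 1 = Suc d"
        using assms mdeg_add[of "r m" "Poly_Mapping.single (X (\<iota> m)) 1"] r by (simp add: form_iff)
      moreover have "Poly_Mapping.keys (r m) \<subseteq> Poly_Mapping.keys m"
        by (auto simp: r_def in_keys_iff lookup_minus)
      then have "Poly_Mapping.keys (r m) \<subseteq> range X"
        using assms m by (auto simp: form_def)
      ultimately show "form d (Poly_Mapping.single (r m) (Poly_Mapping.lookup f m))"
        by (simp add: form_iff)
    qed
    have "g i * Var (X i) = (\<Sum>m\<in>{m\<in>?K. \<iota> m = i}. Poly_Mapping.single m (Poly_Mapping.lookup f m))" for i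
      unfolding g_def sum_distrib_right using r by (intro sum.cong) (auto simp: Var_def mult_single)
    then have "(\<Sum>i\<in>UNIV. g i * Var (X i)) = (\<Sum>m\<in>?K. Poly_Mapping.single m (Poly_Mapping.lookup f m))"
      by (simp add: sum.group)
    then show "f = (\<Sum>i\<in>UNIV. g i * Var (X i))"
      by (simp add: poly_mapping_sum_singles)
  qed
qed

lemma form_0_cases:
  assumes "form 0 f"
  obtains c where "f = Const c"
proof -
  have "m = 0" if "m \<in> Poly_Mapping.keys f" for m
    using assms that by (intro poly_mapping_eqI) (auto simp: form_def in_keys_iff)
  then have "f = Const (Poly_Mapping.lookup f 0)"
    by (intro poly_mapping_eqI) (auto simp: Const_def lookup_single when_def in_keys_iff)
  then show thesis by (rule that)
qed

lemma form_1_cases: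
  assumes "form 1 f"
  obtains \<alpha> where "f = linear_form \<alpha>"
proof -
  obtain g where g: "\<And>i. form 0 (g i)" "f = (\<Sum>i\<in>UNIV. g i * Var (X i))"
    using form_Suc_cases[of 0 f] assms by auto
  have "\<forall>i. \<exists>c. g i = Const c"
    using form_0_cases g(1) by blast
  then obtain \<alpha> where "\<And>i. g i = Const (\<alpha> i)"
    by metis
  then show thesis using that[of \<alpha>] g(2) by (simp add: linear_form_def)
qed

lemma cubic_expand: "cubic F = (\<Sum>i\<in>UNIV. \<Sum>j\<in>UNIV. \<Sum>k\<in>UNIV. Const (F i j k) * (Var (X i) * Var (X j) * Var (X k)))"
  by (simp add: cubic_def linear_form_def sum_distrib_left sum_distrib_right ac_simps)

lemma cubic_perm:
  "cubic (\<lambda>i j k. F j i k) = cubic F" "cubic (\<lambda>i j k. F i k j) = cubic F"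
proof -
  show "cubic (\<lambda>i j k. F j i k) = cubic F"
    unfolding cubic_expand by (subst sum.swap) (simp add: ac_simps)
  have *: "(\<Sum>j\<in>UNIV. \<Sum>k\<in>UNIV. Const (F i k j) * (Var (X i) * Var (X j) * Var (X k))) =
      (\<Sum>j\<in>UNIV. \<Sum>k\<in>UNIV. Const (F i j k) * (Var (X i) * Var (X j) * Var (X k)))" for i
    by (subst sum.swap) (simp add: ac_simps)
  show "cubic (\<lambda>i j k. F i k j) = cubic F"
    unfolding cubic_expand * ..
qed

lemma cubic_add: "cubic (\<lambda>i j k. F i j k + G i j k) = cubic F + cubic G"
  and cubic_scale: "cubic (\<lambda>i j k. c * F i j k) = Const c * cubic F"
  by (simp_all add: cubic_expand Const_add Const_mult sum_distrib_left algebra_simps sum.distrib)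

lemma form_3_cases:
  assumes "form 3 f"
  obtains F where "sym3 F" "f = cubic F"
proof -
  obtain g where g: "\<And>i. form 2 (g i)" "f = (\<Sum>i\<in>UNIV. g i * Var (X i))"
    using form_Suc_cases[of 2 f] assms by auto
  have "\<exists>h. (\<forall>j. form 1 (h j)) \<and> g i = (\<Sum>j\<in>UNIV. h j * Var (X j))" for i
    using form_Suc_cases[of 1 "g i"] g(1)[of i] by (metis Suc_1)
  then obtain h where h: "\<And>i j. form 1 (h i j)" "\<And>i. g i = (\<Sum>j\<in>UNIV. h i j * Var (X j))"
    by metis
  have "\<forall>i j. \<exists>\<alpha>. h i j = linear_form \<alpha>"
    using form_1_cases h(1) by blast
  then obtain F where F: "\<And>i j. h i j = linear_form (F i j)"
    unfolding choice_iff by blast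
  have f: "f = cubic F"
    by (simp add: g(2) h(2) F cubic_def)
  \<comment> \<open>The average over the six index permutations is symmetric and, by
    \<open>cubic_perm\<close>, yields the same polynomial.\<close>
  define G where "G i j k = 1 / 6 * (F i j k + F i k j + F j i k + F j k i + F k i j + F k j i)" for i j k
  have "cubic G = Const (1 / 6) * (cubic F + cubic F + cubic F + cubic F + cubic F + cubic F)"
    unfolding G_def cubic_scale cubic_add
    using cubic_perm(1)[of F] cubic_perm(2)[of F]
      cubic_perm(1)[of "\<lambda>i j k. F i k j"] cubic_perm(2)[of "\<lambda>i j k. F j i k"]
      cubic_perm(1)[of "\<lambda>i j k. F k i j"]
    by simp
  also have "\<dots> = Const (1 / 6) * Const 6 * cubic F"
    by (simp add: algebra_simps)
  also have "Const (1 / 6) * Const 6 = 1"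
    by (simp only: flip: Const_mult) simp
  finally have "f = cubic G" using f by simp
  moreover have "sym3 G"
    by (simp add: sym3_def G_def)
  ultimately show thesis using that by blast
qed

lemma linear_in_XU [simp]: "linear_form \<alpha> \<in> XU"
  unfolding linear_form_def by (auto intro!: poly_over_sum)

lemma VarX_in_XU [simp]: "Var (X i) \<in> XU" and VarU_in_XU [simp]: "Var (U i) \<in> XU"
  by auto

lemma cubic_in_XU [simp]: "cubic F \<in> XU"
  unfolding cubic_def by (intro poly_over_sum poly_over.mult linear_in_XU VarX_in_XU)

lemma pdiff_combination: "pdiff (X l) (\<Sum>i\<in>UNIV. g i * Var (X i)) =
    g l + (\<Sum>i\<in>UNIV. pdiff (X l) (g i) * Var (X i))"
  by (simp add: pdiff_sum pdiff_Var sum.distrib if_distrib[of "\<lambda>x. _ * x"] cong: if_cong)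

lemma pdiff_linear [simp]: "pdiff (X l) (linear_form \<alpha>) = Const (\<alpha> l)"
  unfolding linear_form_def pdiff_combination by simp

text \<open>By symmetry all index positions contribute alike: three to the first derivative and two
  to the second.\<close>

lemma hess_cubic:
  assumes "sym3 F"
  shows "hess (cubic F) l m = 6 * linear_form (F l m)"
proof -
  have [simp]: "(\<Sum>i\<in>UNIV. Const (F i j k) * Var (X i)) = linear_form (F j k)"
    "(\<Sum>i\<in>UNIV. Const (F j i k) * Var (X i)) = linear_form (F j k)" for j k
    unfolding linear_form_def by (metis (no_types, lifting) assms sym3D sum.cong)+
  have sym: "linear_form (F i j) = linear_form (F j i)" for i j
    by (metis assms sym3D ext)
  have "pdiff (X m) (cubic F) = 3 * (\<Sum>j\<in>UNIV. linear_form (F m j) * Var (X j))"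
    unfolding cubic_def pdiff_combination
    by (simp add: distrib_right sum.distrib sym[of _ m] mult.assoc flip: sum_distrib_left)
  then show ?thesis
    by (simp add: pdiff_combination sym[of l m])
qed

section \<open>The concomitants of a cubic\<close>

text \<open>Equal to -2 times the determinant of the Hessian bordered by u.\<close>

definition bordered_hess :: "polynomial \<Rightarrow> polynomial" where
  "bordered_hess p = adjp (hess p) (hess p) (\<lambda>i. Var (U i))"

lemma adjp_in_poly_over:
  assumes "\<And>i j. A i j \<in> poly_over V" "\<And>i j. B i j \<in> poly_over V" "\<And>i. u i \<in> poly_over V"
  shows "adjp A B u \<in> poly_over V"
  using assms poly_over.Const[of 2 V] by (simp add: adjp_def)

lemma theta_eq:
  assumes "f \<in> XU"
  shows "theta f = Const (1 / 2) * bordered_hess f"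
proof -
  have "theta f = Const (1 / 4) * Const 2 * bordered_hess f"
    using assms by (simp add: theta_def transvectant_u_x bordered_hess_def)
  moreover have "Const (1 / 4) * Const 2 = Const (1 / 2)"
    by (simp only: flip: Const_mult) simp
  ultimately show ?thesis by metis
qed

lemma theta_in_XU: "f \<in> XU \<Longrightarrow> theta f \<in> XU"
  by (simp add: theta_eq bordered_hess_def adjp_in_poly_over)

lemma F6u_eq:
  assumes "f \<in> XU"
  shows "F6u f = Const (1 / 1536) * bordered_hess (theta f)"
proof -
  have "F6u f = Const (1 / 3072) * Const 2 * bordered_hess (theta f)"
    using theta_in_XU[OF assms] by (simp add: F6u_def transvectant_u_x bordered_hess_def)
  moreover have "Const (1 / 3072) * Const 2 = Const (1 / 1536)"
    by (simp only: flip: Const_mult) simp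
  ultimately show ?thesis by metis
qed

lemma adjp_commute: "adjp A B u = adjp B A u"
  by (simp add: adjp_def algebra_simps)

lemma adjp_0 [simp]: "adjp (\<lambda>_ _. 0) B u = 0" "adjp A (\<lambda>_ _. 0) u = 0"
  by (simp_all add: adjp_def)

lemma pdiff_adjp:
  assumes "\<And>i. pdiff v (u i) = 0"
  shows "pdiff v (adjp A B u) =
    adjp (\<lambda>i j. pdiff v (A i j)) B u + adjp A (\<lambda>i j. pdiff v (B i j)) u"
  using assms by (simp add: adjp_def power2_eq_square algebra_simps)

lemma psubst_adjp: "psubst \<sigma> (adjp A B u) =
    adjp (\<lambda>i j. psubst \<sigma> (A i j)) (\<lambda>i j. psubst \<sigma> (B i j)) (\<lambda>i. psubst \<sigma> (u i))"
  by (simp add: adjp_def)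

lemma Const_adjp: "Const (adjp A B u) =
    adjp (\<lambda>i j. Const (A i j)) (\<lambda>i j. Const (B i j)) (\<lambda>i. Const (u i))"
  by (simp add: adjp_def Const_add Const_diff Const_mult Const_power)

lemma adjp_combination:
  "adjp (\<lambda>i j. \<Sum>k\<in>UNIV. p k * A k i j) B u = (\<Sum>k\<in>(UNIV :: 3 set). p k * adjp (A k) B u)"
  by (simp add: adjp_def sum_3 algebra_simps)

lemma adjp_scale: "adjp (\<lambda>i j. c * A i j) (\<lambda>i j. c * A i j) u = c\<^sup>2 * adjp A A u"
  by (simp add: adjp_def algebra_simps power2_eq_square)

text \<open>Since \<open>adjp\<close> is bilinear in the matrices, the contraction moves inside,
  where \<open>adjp_cross\<close> applies once more.\<close>

lemma bil_adjp:
  "bil (\<lambda>k l. adjp (A k) (A l) u) p q =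
     adjp (\<lambda>i j. \<Sum>k\<in>UNIV. p k * A k i j) (\<lambda>i j. \<Sum>k\<in>UNIV. q k * A k i j) u"
  unfolding adjp_combination adjp_commute[of _ "\<lambda>i j. \<Sum>k\<in>UNIV. q k * A k i j"]
  by (simp add: bil_def adjp_commute[of "A _" "A _"] sum_distrib_left ac_simps)

lemma bil_combination: "bil (\<lambda>i j. \<Sum>k\<in>UNIV. p k * F k i j) q r = tri F p q r"
  by (simp add: bil_def tri_def sum_3 algebra_simps)

lemma theta_cubic:
  assumes "sym3 F"
  shows "theta (cubic F) = Const 18 *
    adjp (\<lambda>i j. linear_form (F i j)) (\<lambda>i j. linear_form (F i j)) (\<lambda>i. Var (U i))"
proof -
  have "Const (1 / 2) * Const 36 = Const 18"
    by (simp only: flip: Const_mult) simp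
  moreover have "theta (cubic F) = Const (1 / 2) * (Const 36 *
      adjp (\<lambda>i j. linear_form (F i j)) (\<lambda>i j. linear_form (F i j)) (\<lambda>i. Var (U i)))"
    unfolding theta_eq[OF cubic_in_XU] bordered_hess_def hess_cubic[OF assms]
    by (simp add: adjp_def algebra_simps)
  ultimately show ?thesis by (simp only: mult.assoc[symmetric])
qed

text \<open>The matrix entries in \<open>theta_cubic\<close> are linear in x, so two derivatives
  replace them by constants. The two orders of differentiation double the factor 18.\<close>

lemma hess_theta_cubic:
  assumes "sym3 F"
  shows "hess (theta (cubic F)) k l = Const 36 *
    adjp (\<lambda>i j. Const (F k i j)) (\<lambda>i j. Const (F l i j)) (\<lambda>i. Var (U i))"
proof -
  have sym: "F k i j = F i j k" for i j k
    by (metis assms sym3D)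
  show ?thesis
    unfolding theta_cubic[OF assms] sym[of k] sym[of l]
    by (simp add: pdiff_adjp pdiff_Var
        adjp_commute[of "\<lambda>i j. Const (F i j l)" "\<lambda>i j. Const (F i j k)"])
qed

text \<open>\<open>adjp_cross\<close> is used for \<open>T\<close> and for its entries. With A, B,
  C, D the arguments of \<open>disc3\<close>, \<open>T\<close> has on p, q the values 2 (A C - B^2),
  A D - B C, 2 (B D - C^2), so its Gram determinant is minus \<open>disc3\<close>. The constant is
  -2 * 36^2 / 1536.\<close>

lemma psubst_F6u_cross:
  assumes F: "sym3 F" and \<sigma>: "\<And>i. \<sigma> (U i) = Const (cross p q i)"
  shows "psubst \<sigma> (F6u (cubic F)) = Const (- (27 / 16) *
    disc3 (tri F p p p) (tri F p p q) (tri F p q q) (tri F q q q))"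
proof -
  let ?u = "cross p q"
  define T where "T k l = adjp (F k) (F l) ?u" for k l
  have symF: "F k i j = F k j i" for k i j
    by (metis F sym3D)
  have c: "tri F q p p = tri F p p q" "tri F q p q = tri F p q q"
    by (metis (no_types) tri_commute[OF F])+
  have T: "bil T r s = bil (\<lambda>i j. \<Sum>k\<in>UNIV. r k * F k i j) p p * bil (\<lambda>i j. \<Sum>k\<in>UNIV. s k * F k i j) q q
      + bil (\<lambda>i j. \<Sum>k\<in>UNIV. s k * F k i j) p p * bil (\<lambda>i j. \<Sum>k\<in>UNIV. r k * F k i j) q q
      - 2 * bil (\<lambda>i j. \<Sum>k\<in>UNIV. r k * F k i j) p q * bil (\<lambda>i j. \<Sum>k\<in>UNIV. s k * F k i j) p q" for r s
    unfolding T_def bil_adjp by (rule adjp_cross) (simp_all add: symF)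
  have "adjp T T ?u = bil T p p * bil T q q + bil T p p * bil T q q - 2 * bil T p q * bil T p q"
    by (rule adjp_cross) (simp_all add: T_def adjp_commute)
  also have "\<dots> = - 2 * disc3 (tri F p p p) (tri F p p q) (tri F p q q) (tri F q q q)"
    unfolding T bil_combination c disc3_def by algebra
  finally have *: "adjp (\<lambda>k l. 36 * T k l) (\<lambda>k l. 36 * T k l) ?u =
      - 2592 * disc3 (tri F p p p) (tri F p p q) (tri F p q q) (tri F q q q)"
    using adjp_scale[of 36 T ?u] by simp
  have "psubst \<sigma> (F6u (cubic F)) = Const (1 / 1536) *
      Const (adjp (\<lambda>k l. 36 * T k l) (\<lambda>k l. 36 * T k l) ?u)"
    unfolding F6u_eq[OF cubic_in_XU] bordered_hess_def hess_theta_cubic[OF F]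
    by (simp add: psubst_adjp \<sigma> Const_adjp T_def Const_mult)
  then show ?thesis
    unfolding * Const_mult[symmetric] by simp
qed

lemma cubic_square_times_linear:
  obtains F where "sym3 F" "cubic F = (linear_form \<alpha>)\<^sup>2 * linear_form \<beta>"
    "\<And>x. tri F x x x = (\<Sum>i\<in>UNIV. \<alpha> i * x i)\<^sup>2 * (\<Sum>i\<in>UNIV. \<beta> i * x i)"
proof -
  \<comment> \<open>The symmetrization of \<open>\<alpha> i * \<alpha> j * \<beta> k\<close>,
    because \<open>tri_polarization\<close> compares symmetric arrays.\<close>
  define F where "F i j k = 1 / 3 * (\<alpha> i * \<alpha> j * \<beta> k + \<alpha> i * \<beta> j * \<alpha> k + \<beta> i * \<alpha> j * \<alpha> k)" for i j k
  define G where "G i j k = \<alpha> i * \<alpha> j * \<beta> k" for i j k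
  have "cubic F = Const (1 / 3) * (cubic G + cubic G + cubic G)"
    unfolding F_def cubic_scale cubic_add G_def
    using cubic_perm(2)[of "\<lambda>i j k. \<alpha> i * \<alpha> j * \<beta> k"] cubic_perm(1)[of "\<lambda>i j k. \<alpha> i * \<beta> j * \<alpha> k"]
    by (simp add: ac_simps)
  also have "\<dots> = Const (1 / 3) * Const 3 * cubic G"
    by (simp add: algebra_simps)
  also have "Const (1 / 3) * Const 3 = 1"
    by (simp only: flip: Const_mult) simp
  also have "cubic G = (linear_form \<alpha>)\<^sup>2 * linear_form \<beta>"
    unfolding cubic_expand G_def linear_form_def power2_eq_square sum_product sum_distrib_right
      sum_distrib_left
    by (simp add: Const_mult sum_3 algebra_simps)
  finally have cubic: "cubic F = (linear_form \<alpha>)\<^sup>2 * linear_form \<beta>" by simp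
  have "sym3 F"
    by (simp add: sym3_def F_def)
  moreover note cubic
  moreover have "tri F x x x = (\<Sum>i\<in>UNIV. \<alpha> i * x i)\<^sup>2 * (\<Sum>i\<in>UNIV. \<beta> i * x i)" for x
    unfolding tri_def bil_def sum_3 F_def by (simp add: field_simps power2_eq_square)
  ultimately show thesis by (rule that)
qed

text \<open>The values of \<open>F6u f\<close> at cross products give all \<open>disc3\<close>,
  hence a factorization at every point, which polarization turns into an identity of
  polynomials.\<close>

lemma square_factor_if_F6u_eq_0:
  assumes "form 3 f" "F6u f = 0"
  obtains \<alpha> \<beta> where "f = (linear_form \<alpha>)\<^sup>2 * linear_form \<beta>"
proof -
  obtain F where F: "sym3 F" "f = cubic F"
    using form_3_cases assms(1) by blast
  have "disc3 (tri F p p p) (tri F p p q) (tri F p q q) (tri F q q q) = 0" for p q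
  proof -
    let ?\<sigma> = "\<lambda>v. case v of U i \<Rightarrow> Const (cross p q i) | _ \<Rightarrow> 0"
    have "psubst ?\<sigma> (F6u (cubic F)) = 0"
      using assms(2) F(2) by simp
    then show ?thesis
      by (subst (asm) psubst_F6u_cross[OF F(1)]) simp_all
  qed
  then obtain \<alpha> \<beta> where ab: "\<And>x. tri F x x x = (\<Sum>i\<in>UNIV. \<alpha> i * x i)\<^sup>2 * (\<Sum>i\<in>UNIV. \<beta> i * x i)"
    using square_factor_if_disc3_eq_0[OF F(1)] by blast
  obtain G where G: "sym3 G" "cubic G = (linear_form \<alpha>)\<^sup>2 * linear_form \<beta>"
    "\<And>x. tri G x x x = (\<Sum>i\<in>UNIV. \<alpha> i * x i)\<^sup>2 * (\<Sum>i\<in>UNIV. \<beta> i * x i)"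
    by (rule cubic_square_times_linear[of \<alpha> \<beta>]) blast
  have "F = G"
    using ab G(3) by (intro tri_polarization F(1) G(1)) simp
  then show thesis
    using that F(2) G(2) by blast
qed

section \<open>Functions of two linear forms and the determinant det(\<alpha>, \<beta>, u)\<close>

definition bracket :: "(3 \<Rightarrow> complex) \<Rightarrow> (3 \<Rightarrow> complex) \<Rightarrow> polynomial" where
  "bracket \<alpha> \<beta> = (\<Sum>i\<in>UNIV. Const (cross \<alpha> \<beta> i) * Var (U i))"

lemma bracket_in_XU [simp]: "bracket \<alpha> \<beta> \<in> XU"
  unfolding bracket_def by (intro poly_over_sum poly_over.mult poly_over.Const VarU_in_XU)

lemma pdiff_bracket [simp]: "pdiff (X i) (bracket \<alpha> \<beta>) = 0"
  by (simp add: bracket_def pdiff_sum pdiff_Var)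

lemma bracket_eq_0_iff: "bracket \<alpha> \<beta> = 0 \<longleftrightarrow> (\<forall>i. cross \<alpha> \<beta> i = 0)"
proof
  assume 0: "bracket \<alpha> \<beta> = 0"
  show "\<forall>i. cross \<alpha> \<beta> i = 0"
  proof
    fix i
    have "psubst (\<lambda>v. case v of U j \<Rightarrow> Const (basis i j) | _ \<Rightarrow> 0) (bracket \<alpha> \<beta>) = Const (cross \<alpha> \<beta> i)"
      using exhaust_3[of i] by (auto simp: bracket_def sum_3 basis_def)
    then show "cross \<alpha> \<beta> i = 0" using 0 by simp
  qed
qed (simp add: bracket_def)

text \<open>
  The matrix \<open>r \<alpha>\<alpha>\<^sup>T + s (\<alpha>\<beta>\<^sup>T + \<beta>\<alpha>\<^sup>T) + t \<beta>\<beta>\<^sup>T\<close> has rank at most two, so its adjugate is a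
  multiple of \<open>(\<alpha> \<times> \<beta>) (\<alpha> \<times> \<beta>)\<^sup>T\<close>.
\<close>

lemma adjp_pencil:
  assumes "\<And>i j. A i j = r * (Const (\<alpha> i) * Const (\<alpha> j)) +
    s * (Const (\<alpha> i) * Const (\<beta> j) + Const (\<beta> i) * Const (\<alpha> j)) + t * (Const (\<beta> i) * Const (\<beta> j))"
  shows "adjp A A (\<lambda>i. Var (U i)) = 2 * (r * t - s\<^sup>2) * (bracket \<alpha> \<beta>)\<^sup>2"
  unfolding adjp_def bracket_def sum_3 cross_simps assms Const_diff Const_mult
  by (simp add: power2_eq_square algebra_simps)

text \<open>For f = phi(a, b) with linear forms a, b, the coefficients r, s, t are the second
  partials of phi, so r t - s^2 is its binary Hessian determinant.\<close>

lemma theta_pencil: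
  assumes "f \<in> XU" "\<And>i j. hess f i j = r * (Const (\<alpha> i) * Const (\<alpha> j)) +
    s * (Const (\<alpha> i) * Const (\<beta> j) + Const (\<beta> i) * Const (\<alpha> j)) + t * (Const (\<beta> i) * Const (\<beta> j))"
  shows "theta f = (r * t - s\<^sup>2) * (bracket \<alpha> \<beta>)\<^sup>2"
proof -
  have "Const (1 / 2) * Const 2 = 1"
    by (simp only: flip: Const_mult) simp
  then have "Const (1 / 2) * (2 * p) = p" for p
    by (simp flip: mult.assoc)
  then show ?thesis
    unfolding theta_eq[OF assms(1)] bordered_hess_def adjp_pencil[OF assms(2)]
    by (simp only: mult.assoc)
qed

lemma theta_square_times_linear:
  "theta ((linear_form \<alpha>)\<^sup>2 * linear_form \<beta>) = - 4 * (linear_form \<alpha>)\<^sup>2 * (bracket \<alpha> \<beta>)\<^sup>2"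
proof -
  \<comment> \<open>The second partials of a^2 b are 2 b, 2 a and 0.\<close>
  have "theta ((linear_form \<alpha>)\<^sup>2 * linear_form \<beta>) =
      (2 * linear_form \<beta> * 0 - (2 * linear_form \<alpha>)\<^sup>2) * (bracket \<alpha> \<beta>)\<^sup>2"
    by (rule theta_pencil) (simp_all add: power2_eq_square algebra_simps)
  then show ?thesis by (simp add: algebra_simps power2_eq_square)
qed

text \<open>Up to an x-free factor \<open>theta\<close> is the square of one linear form, so its
  Hessian has rank at most one and zero adjugate.\<close>

lemma F6u_square_times_linear: "F6u ((linear_form \<alpha>)\<^sup>2 * linear_form \<beta>) = 0"
proof -
  have "hess (theta ((linear_form \<alpha>)\<^sup>2 * linear_form \<beta>)) i j =
      - 8 * (bracket \<alpha> \<beta>)\<^sup>2 * (Const (\<alpha> i) * Const (\<alpha> j)) +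
      0 * (Const (\<alpha> i) * Const (\<beta> j) + Const (\<beta> i) * Const (\<alpha> j)) + 0 * (Const (\<beta> i) * Const (\<beta> j))" for i j
    unfolding theta_square_times_linear by (simp add: power2_eq_square algebra_simps)
  from adjp_pencil[OF this] show ?thesis
    by (simp add: F6u_eq bordered_hess_def)
qed

lemma theta_sum_of_two_cubes:
  "theta (linear_form \<kappa> ^ 3 + linear_form \<mu> ^ 3) = 36 * linear_form \<kappa> * linear_form \<mu> * (bracket \<kappa> \<mu>)\<^sup>2"
proof -
  have "theta (linear_form \<kappa> ^ 3 + linear_form \<mu> ^ 3) =
      (6 * linear_form \<kappa> * (6 * linear_form \<mu>) - 0\<^sup>2) * (bracket \<kappa> \<mu>)\<^sup>2"
    by (rule theta_pencil) (simp_all add: power3_eq_cube algebra_simps)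
  then show ?thesis by (simp add: algebra_simps)
qed

text \<open>Up to an x-free factor \<open>theta\<close> is the product of the two linear forms, so
  only the mixed coefficient of the pencil survives.\<close>

lemma F6u_sum_of_two_cubes:
  "F6u (linear_form \<kappa> ^ 3 + linear_form \<mu> ^ 3) = Const (- (27 / 16)) * bracket \<kappa> \<mu> ^ 6"
proof -
  have "hess (theta (linear_form \<kappa> ^ 3 + linear_form \<mu> ^ 3)) i j =
      0 * (Const (\<kappa> i) * Const (\<kappa> j)) +
      36 * (bracket \<kappa> \<mu>)\<^sup>2 * (Const (\<kappa> i) * Const (\<mu> j) + Const (\<mu> i) * Const (\<kappa> j)) +
      0 * (Const (\<mu> i) * Const (\<mu> j))" for i j
    unfolding theta_sum_of_two_cubes by (simp add: power2_eq_square algebra_simps)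
  from adjp_pencil[OF this]
  have "F6u (linear_form \<kappa> ^ 3 + linear_form \<mu> ^ 3) = Const (1 / 1536) * Const (- 2592) * bracket \<kappa> \<mu> ^ 6"
    by (simp add: F6u_eq bordered_hess_def eval_nat_numeral algebra_simps Const_minus)
  then show ?thesis unfolding Const_mult[symmetric] by simp
qed

section \<open>Linear independence through the cross product\<close>

lemma cross_eq_0_iff:
  fixes \<alpha> \<beta> :: "3 \<Rightarrow> complex"
  shows "(\<forall>i. cross \<alpha> \<beta> i = 0) \<longleftrightarrow> (\<forall>i j. \<alpha> i * \<beta> j = \<beta> i * \<alpha> j)"
  unfolding forall_3 by (auto simp: algebra_simps)

lemma linear_form_combination:
  "linear_form (\<lambda>i. s * \<alpha> i + t * \<beta> i) = Const s * linear_form \<alpha> + Const t * linear_form \<beta>"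
  by (simp add: linear_form_def Const_add Const_mult sum_distrib_left sum.distrib algebra_simps)

lemma linear_form_eq_0_iff: "linear_form \<alpha> = 0 \<longleftrightarrow> (\<forall>i. \<alpha> i = 0)"
proof
  assume "linear_form \<alpha> = 0"
  then have "pdiff (X i) (linear_form \<alpha>) = 0" for i
    by simp
  then show "\<forall>i. \<alpha> i = 0"
    by simp
qed (simp add: linear_form_def)

lemma lin_indep_linear_form_iff:
  "lin_indep (linear_form \<alpha>) (linear_form \<beta>) \<longleftrightarrow> (\<exists>i. cross \<alpha> \<beta> i \<noteq> 0)"
proof -
  have "(\<forall>i. cross \<alpha> \<beta> i = 0) \<longleftrightarrow> (\<exists>s t. (\<forall>i. s * \<alpha> i + t * \<beta> i = 0) \<and> (s \<noteq> 0 \<or> t \<noteq> 0))"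
  proof (intro iffI)
    assume *: "\<forall>i. cross \<alpha> \<beta> i = 0"
    show "\<exists>s t. (\<forall>i. s * \<alpha> i + t * \<beta> i = 0) \<and> (s \<noteq> 0 \<or> t \<noteq> 0)"
    proof (cases "\<forall>i. \<alpha> i = 0")
      case True
      then show ?thesis by (intro exI[of _ 1] exI[of _ 0]) simp
    next
      case False
      then obtain k where "\<alpha> k \<noteq> 0" by blast
      \<comment> \<open>The vanishing minors say that \<open>\<beta> k\<close> times \<alpha> equals
        \<open>\<alpha> k\<close> times \<beta>, a nontrivial relation as \<open>\<alpha> k\<close>
        is nonzero.\<close>
      then show ?thesis
        using * unfolding cross_eq_0_iff
        by (intro exI[of _ "\<beta> k"] exI[of _ "- \<alpha> k"]) simp
    qed
  next
    assume "\<exists>s t. (\<forall>i. s * \<alpha> i + t * \<beta> i = 0) \<and> (s \<noteq> 0 \<or> t \<noteq> 0)"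
    then obtain s t where st: "\<And>i. s * \<alpha> i + t * \<beta> i = 0" "s \<noteq> 0 \<or> t \<noteq> 0" by blast
    have "s * (\<alpha> i * \<beta> j - \<beta> i * \<alpha> j) = 0 \<and> t * (\<alpha> i * \<beta> j - \<beta> i * \<alpha> j) = 0" for i j
      using st(1)[of i] st(1)[of j] by algebra
    then show "\<forall>i. cross \<alpha> \<beta> i = 0"
      unfolding cross_eq_0_iff using st(2) by (metis mult_eq_0_iff right_minus_eq)
  qed
  then show ?thesis
    unfolding lin_indep_def linear_form_combination[symmetric] linear_form_eq_0_iff by blast
qed

lemma theta_square_times_linear_eq_0_iff:
  "theta ((linear_form \<alpha>)\<^sup>2 * linear_form \<beta>) = 0 \<longleftrightarrow> \<not> lin_indep (linear_form \<alpha>) (linear_form \<beta>)"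
proof
  assume "\<not> lin_indep (linear_form \<alpha>) (linear_form \<beta>)"
  then show "theta ((linear_form \<alpha>)\<^sup>2 * linear_form \<beta>) = 0"
    by (simp add: lin_indep_linear_form_iff theta_square_times_linear bracket_eq_0_iff[THEN iffD2])
next
  assume 0: "theta ((linear_form \<alpha>)\<^sup>2 * linear_form \<beta>) = 0"
  show "\<not> lin_indep (linear_form \<alpha>) (linear_form \<beta>)"
  proof
    assume "lin_indep (linear_form \<alpha>) (linear_form \<beta>)"
    then obtain i where i: "cross \<alpha> \<beta> i \<noteq> 0"
      by (auto simp: lin_indep_linear_form_iff)
    then obtain j where j: "\<alpha> j \<noteq> 0"
      by (metis cross_eq_0_iff mult_zero_left mult_zero_right)
    \<comment> \<open>Evaluation at x = e_j and u = e_i, where both factors of \<open>theta\<close>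
      are nonzero.\<close>
    let ?\<sigma> = "\<lambda>v. case v of X k \<Rightarrow> Const (basis j k) | U k \<Rightarrow> Const (basis i k) | _ \<Rightarrow> 0"
    have "psubst ?\<sigma> (linear_form \<alpha>) = Const (\<alpha> j)"
      using exhaust_3[of j] by (auto simp: linear_form_def sum_3 basis_def)
    moreover have "psubst ?\<sigma> (bracket \<alpha> \<beta>) = Const (cross \<alpha> \<beta> i)"
      using exhaust_3[of i] by (auto simp: bracket_def sum_3 basis_def)
    ultimately have "psubst ?\<sigma> (theta ((linear_form \<alpha>)\<^sup>2 * linear_form \<beta>)) =
        Const (- 4 * (\<alpha> j)\<^sup>2 * (cross \<alpha> \<beta> i)\<^sup>2)"
      by (simp add: theta_square_times_linear Const_mult Const_power Const_minus)
    then show False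
      using 0 i j by simp
  qed
qed

section \<open>Lower and upper bounds for the Waring rank\<close>

lemma theta_eq_0_if_sum_of_two_cubes:
  assumes "form 1 l" "form 1 m" "F6u (l ^ 3 + m ^ 3) = 0"
  shows "theta (l ^ 3 + m ^ 3) = 0"
proof -
  obtain \<kappa> \<mu> where lm: "l = linear_form \<kappa>" "m = linear_form \<mu>"
    using assms(1,2) form_1_cases by metis
  have "cross \<kappa> \<mu> i = 0" for i
  proof -
    \<comment> \<open>Evaluation at u = e_i reduces the hypothesis to the sixth power of
      \<open>cross \<kappa> \<mu> i\<close>.\<close>
    let ?\<sigma> = "\<lambda>v. case v of U k \<Rightarrow> Const (basis i k) | _ \<Rightarrow> 0"
    have "psubst ?\<sigma> (bracket \<kappa> \<mu>) = Const (cross \<kappa> \<mu> i)"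
      using exhaust_3[of i] by (auto simp: bracket_def sum_3 basis_def)
    then have "psubst ?\<sigma> (F6u (l ^ 3 + m ^ 3)) = Const (- (27 / 16) * cross \<kappa> \<mu> i ^ 6)"
      unfolding lm F6u_sum_of_two_cubes by (simp only: psubst_mult psubst_power psubst_Const Const_mult Const_power)
    then show ?thesis using assms(3) by simp
  qed
  then show ?thesis
    unfolding lm theta_sum_of_two_cubes by (simp add: bracket_eq_0_iff[THEN iffD2])
qed

text \<open>From (a + b)^3 + (b - a)^3 - 2 b^3 = 6 a^2 b; the cube roots \<open>c\<close> and
  \<open>d\<close> absorb the factors 1/6 and -2/6.\<close>

lemma square_times_linear_sum_of_three_cubes:
  obtains l where "\<And>i. i < 3 \<Longrightarrow> form 1 (l i)"
    "(linear_form \<alpha>)\<^sup>2 * linear_form \<beta> = (\<Sum>i<3::nat. l i ^ 3)"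
proof -
  define c d where "c = complex_of_real (root 3 (1 / 6))" and "d = complex_of_real (- root 3 (1 / 3))"
  have "c ^ 3 = 1 / 6" "d ^ 3 = - (1 / 3)"
    by (simp_all add: c_def d_def flip: of_real_power)
  have "Const 6 * Const c ^ 3 = Const (6 * c ^ 3)"
    by (simp only: Const_mult Const_power)
  also have "\<dots> = 1"
    unfolding \<open>c ^ 3 = 1 / 6\<close> by simp
  finally have c: "Const 6 * Const c ^ 3 = 1" .
  let ?a = "linear_form \<alpha>" and ?b = "linear_form \<beta>"
  \<comment> \<open>The zero summand brings the third form into the pattern of
    \<open>linear_form_combination\<close>.\<close>
  define l where "l i = (if i = 0 then linear_form (\<lambda>k. c * \<alpha> k + c * \<beta> k)
    else if i = 1 then linear_form (\<lambda>k. (- c) * \<alpha> k + c * \<beta> k)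
    else linear_form (\<lambda>k. d * \<beta> k + 0 * \<beta> k))" for i :: nat
  show thesis
  proof (rule that)
    show "form 1 (l i)" for i
      by (simp only: l_def form_linear_form split: if_split) simp
    have "(\<Sum>i<3. l i ^ 3) = (Const c * ?a + Const c * ?b) ^ 3 + (Const c * ?b - Const c * ?a) ^ 3 + (Const d * ?b) ^ 3"
      unfolding l_def linear_form_combination by (simp add: eval_nat_numeral Const_minus)
    also have "\<dots> = Const 6 * Const c ^ 3 * (?a\<^sup>2 * ?b) + (2 * Const c ^ 3 + Const d ^ 3) * ?b ^ 3"
      by (simp add: algebra_simps power2_eq_square power3_eq_cube)
    also have "2 * Const c ^ 3 + Const d ^ 3 = Const (2 * c ^ 3 + d ^ 3)"
      by (simp add: Const_add Const_mult Const_power)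
    also have "2 * c ^ 3 + d ^ 3 = 0"
      using \<open>c ^ 3 = 1 / 6\<close> \<open>d ^ 3 = - (1 / 3)\<close> by algebra
    finally show "?a\<^sup>2 * ?b = (\<Sum>i<3. l i ^ 3)"
      using c by simp
  qed
qed

lemma waring_rank_eq_3:
  assumes f: "f = (linear_form \<alpha>)\<^sup>2 * linear_form \<beta>" and "F6u f = 0" "theta f \<noteq> 0"
  shows "waring_rank 3 f = 3"
  unfolding waring_rank_def
proof (rule Least_equality)
  show "\<exists>l. (\<forall>i<3. form 1 (l i)) \<and> f = (\<Sum>i<3::nat. l i ^ 3)"
    unfolding f by (rule square_times_linear_sum_of_three_cubes[of \<alpha> \<beta>]) blast
  show "3 \<le> r" if r: "\<exists>l. (\<forall>i<r. form 1 (l i)) \<and> f = (\<Sum>i<r. l i ^ 3)" for r :: nat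
  proof (rule ccontr)
    assume "\<not> 3 \<le> r"
    then have "r \<in> {0, 1, 2}" by auto
    obtain l where l: "\<And>i. i < r \<Longrightarrow> form 1 (l i)" "f = (\<Sum>i<r. l i ^ 3)"
      using r by blast
    \<comment> \<open>Padding with zero forms turns at most two cubes into exactly two, which
      excludes the ranks 0, 1 and 2 at once.\<close>
    define k where "k i = (if i < r then l i else 0)" for i
    have "f = k 0 ^ 3 + k 1 ^ 3"
      using \<open>r \<in> {0, 1, 2}\<close> l(2) by (auto simp: k_def eval_nat_numeral)
    moreover have "form 1 (k 0)" "form 1 (k 1)"
      using l(1) form_0 by (auto simp: k_def)
    ultimately show False
      using theta_eq_0_if_sum_of_two_cubes[of "k 0" "k 1"] assms(2,3) by simp
  qed
qed

theorem lemma5p7: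
  fixes f :: polynomial
  assumes "form 3 f"
  shows "(F6u f = 0 \<and> theta f \<noteq> 0 \<longleftrightarrow>
           (\<exists>a b. form 1 a \<and> form 1 b \<and> lin_indep a b \<and> f = a\<^sup>2 * b)) \<and>
         (F6u f = 0 \<and> theta f \<noteq> 0 \<longrightarrow> waring_rank 3 f = 3)"
proof (intro conjI iffI impI)
  assume *: "F6u f = 0 \<and> theta f \<noteq> 0"
  then obtain \<alpha> \<beta> where f: "f = (linear_form \<alpha>)\<^sup>2 * linear_form \<beta>"
    using square_factor_if_F6u_eq_0 assms by blast
  with * have "lin_indep (linear_form \<alpha>) (linear_form \<beta>)"
    by (simp add: theta_square_times_linear_eq_0_iff)
  then show "\<exists>a b. form 1 a \<and> form 1 b \<and> lin_indep a b \<and> f = a\<^sup>2 * b"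
    using f form_linear_form by blast
  show "waring_rank 3 f = 3"
    using waring_rank_eq_3[OF f] * by blast
next
  assume "\<exists>a b. form 1 a \<and> form 1 b \<and> lin_indep a b \<and> f = a\<^sup>2 * b"
  then obtain \<alpha> \<beta> where "lin_indep (linear_form \<alpha>) (linear_form \<beta>)" "f = (linear_form \<alpha>)\<^sup>2 * linear_form \<beta>"
    by (metis form_1_cases)
  then show "F6u f = 0" "theta f \<noteq> 0"
    by (simp_all add: F6u_square_times_linear theta_square_times_linear_eq_0_iff)
qed

end
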